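(* Let $\boldsymbol\mu_1,\dots,\boldsymbol\mu_J\in\mathcal P$ and let $\mathcal V_J$ be the associated snapshot subspace (see context). Let $\boldsymbol\mu\in\mathcal P$, let $s\in\{1,\dots,\dim(\mathcal V_J)\}$ satisfy $\lambda_s^{\mathcal V_J}(\boldsymbol\mu)<\lambda_{s+1}^{\mathcal V_J}(\boldsymbol\mu)$ in case $s<\dim(\mathcal V_J)$, and assume $N\ge 2s$. For $k\in\{1,\dots,s\}$ define $g_{k,\boldsymbol\mu}:\mathbb R\to\mathbb R$ by $g_{k,\boldsymbol\mu}(\eta):=\min\{|\eta-\lambda_j^{\mathcal V_J}(\boldsymbol\mu)|:1\le j\le k\}$, and define $\lambda_k^{\mathrm{SLB}}(\boldsymbol\mu,\mathcal V_J):=\min\{\lambda_k^{\mathcal V_J}(\boldsymbol\mu),\eta_*^{(J)}(\boldsymbol\mu,s)\}$ in case $\rho^{(J)}(\boldsymbol\mu,s)=g_{k,\boldsymbol\mu}(\eta_*^{(J)}(\boldsymbol\mu,s))=0$, and otherwise $$\lambda_k^{\mathrm{SLB}}(\boldsymbol\mu,\mathcal V_J):=\min\{\lambda_k^{\mathcal V_J}(\boldsymbol\mu),\eta_*^{(J)}(\boldsymbol\mu,s)\}-\frac{2\rho^{(J)}(\boldsymbol\mu,s)^2}{g_{k,\boldsymbol\mu}(\eta_*^{(J)}(\boldsymbol\mu,s))+\sqrt{g_{k,\boldsymbol\mu}(\eta_*^{(J)}(\boldsymbol\mu,s))^2+4\rho^{(J)}(\boldsymbol\mu,s)^2}}.$$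 Then for every $k\in\{1,\dots,s\}$, $$\lambda_k^{\mathrm{SLB}}(\boldsymbol\mu,\mathcal V_J)\le\lambda_k(\boldsymbol\mu).$$
   Context: $\mathcal P\subseteq\mathbb R^p$ is compact and $\mathbf A(\boldsymbol\mu)=\sum_{q=1}^Q\theta_q(\boldsymbol\mu)\mathbf A_q\in\mathbb C^{N\times N}$ for $\boldsymbol\mu\in\mathcal P$, with Hermitian $\mathbf A_q$ and real-valued real-analytic $\theta_q$; $\boldsymbol\theta(\boldsymbol\mu):=(\theta_1(\boldsymbol\mu),\dots,\theta_Q(\boldsymbol\mu))^\top$. Eigenvalues of $\mathbf A(\boldsymbol\mu)$ with multiplicity: $\lambda_1(\boldsymbol\mu)\le\dots\le\lambda_N(\boldsymbol\mu)$, with orthonormal eigenvectors $\mathbf w_1(\boldsymbol\mu),\dots,\mathbf w_N(\boldsymbol\mu)$. For a Hermitian (or real-spectrum) matrix $\mathbf M$, $\lambda_1(\mathbf M)$ is its smallest eigenvalue; $\lambda_N(\mathbf A_q)$ is the largest eigenvalue of $\mathbf A_q$. Standing assumption: there is $2\le m_0<N$ ($m_0\ll N$) such that for all $\boldsymbol\mu\in\mathcal P$ the second smallest distinct eigenvalue of $\mathbf A(\boldsymbol\mu)$ is $\le\lambda_{m_0}(\boldsymbol\mu)$ and $\lambda_{m_0}(\boldsymbol\mu)<\lambda_{m_0+1}(\boldsymbol\mu)$. $\|\cdot\|$ is the spectral norm. Snapshot subspace: for integers $1\le\ell(j)<N$ ($\ell(j)\ll N$), $j=1,\dots,J$, $\mathcal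 V_J:=\operatorname{span}\{\mathbf w_1(\boldsymbol\mu_j),\dots,\mathbf w_{\ell(j)}(\boldsymbol\mu_j):1\le j\le J\}$; $\mathbf V_J$ is a matrix whose columns form an orthonormal basis of $\mathcal V_J$. $\lambda_k^{\mathcal V_J}(\boldsymbol\mu)$ is the $k$-th smallest eigenvalue (with multiplicity) of $\mathbf V_J^*\mathbf A(\boldsymbol\mu)\mathbf V_J$, with orthonormal eigenvectors $\mathbf w_k^{\mathbf V_J}(\boldsymbol\mu)$. For $s$ as in the claim: $\mathbf U_J(\boldsymbol\mu,s):=[\mathbf V_J\mathbf w_1^{\mathbf V_J}(\boldsymbol\mu)\ \cdots\ \mathbf V_J\mathbf w_s^{\mathbf V_J}(\boldsymbol\mu)]$, $\mathbf U_J^\perp(\boldsymbol\mu,s)$ is a matrix whose columns form an orthonormal basis of the orthogonal complement of the column space of $\mathbf U_J(\boldsymbol\mu,s)$, and $\rho^{(J)}(\boldsymbol\mu,s):=\|\mathbf U_J^\perp(\boldsymbol\mu,s)^*\mathbf A(\boldsymbol\mu)\mathbf U_J(\boldsymbol\mu,s)\|$. For $j=1,\dots,J$ let $\boldsymbol\Lambda^{(j)}:=\operatorname{diag}(\lambda_1(\boldsymbol\mu_j),\dots,\lambda_{\ell(j)}(\boldsymbol\mu_j))$, $\mathbf W^{(j)}:=[\mathbf w_1(\boldsymbol\mu_j)\cdots\mathbf w_{\ell(j)}(\boldsymbol\mu_j)]$ and, with $\mathbf U=\mathbf U_J(\boldsymbol\mu,s)$ and $\mathbf I$ the identity of size $\ell(j)$,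 $$\beta^{(j,J)}(\boldsymbol\mu,s):=\lambda_1\Big((\boldsymbol\Lambda^{(j)}-\lambda_1(\boldsymbol\mu_j)\mathbf I)-(\mathbf W^{(j)})^*\mathbf U\mathbf U^*\mathbf W^{(j)}(\boldsymbol\Lambda^{(j)}-\lambda_{\ell(j)+1}(\boldsymbol\mu_j)\mathbf I)\Big)$$ (the matrix has real spectrum). Let $\mathcal B:=\prod_{q=1}^Q[\lambda_1(\mathbf A_q),\lambda_N(\mathbf A_q)]$, $\mathcal Y_J^{\mathrm{LB}}(\boldsymbol\mu,s):=\{\mathbf y\in\mathcal B:\boldsymbol\theta(\boldsymbol\mu_j)^\top\mathbf y\ge\lambda_1(\boldsymbol\mu_j)+\beta^{(j,J)}(\boldsymbol\mu,s),\ j=1,\dots,J\}$ and $\eta_*^{(J)}(\boldsymbol\mu,s):=\min\{\boldsymbol\theta(\boldsymbol\mu)^\top\mathbf y:\mathbf y\in\mathcal Y_J^{\mathrm{LB}}(\boldsymbol\mu,s)\}$. *)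

theory Defs
  imports
    "HOL-Analysis.Analysis"
    "Jordan_Normal_Form.Schur_Decomposition"
    "Jordan_Normal_Form.Spectral_Radius"
    "Jordan_Normal_Form.DL_Rank"
begin

(* Matrices and vectors whose sizes are natural numbers are those of Jordan_Normal_Form;
   real ^ 'p is only used for the parameter space. The Analysis constants of the same name
   as a Jordan_Normal_Form constant are avoided by qualification. *)

section \<open>Real-analytic functions\<close>

(* The value of f off S is irrelevant: near each point of S, f agrees on S with an (absolutely)
   convergent power series in several variables; \<alpha> ranges over the multi-indices. *)
definition real_analytic_on :: "((real, 'p::finite) Finite_Cartesian_Product.vec \<Rightarrow> real)
    \<Rightarrow> (real, 'p) Finite_Cartesian_Product.vec set \<Rightarrow> bool" where
  "real_analytic_on f S \<longleftrightarrow>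
    (\<forall>x\<in>S. \<exists>r>0. \<exists>c :: ('p \<Rightarrow> nat) \<Rightarrow> real.
       (\<forall>y\<in>ball x r. (\<lambda>\<alpha>. c \<alpha> * (\<Prod>i\<in>UNIV. (vec_nth y i - vec_nth x i) ^ \<alpha> i)) summable_on UNIV) \<and>
       (\<forall>y\<in>ball x r \<inter> S.
          f y = (\<Sum>\<^sub>\<infinity>\<alpha>. c \<alpha> * (\<Prod>i\<in>UNIV. (vec_nth y i - vec_nth x i) ^ \<alpha> i))))"


section \<open>Hermitian matrices, eigenvalues and norms\<close>

definition hermitian :: "complex mat \<Rightarrow> bool" where
  "hermitian M \<longleftrightarrow> mat_adjoint M = M"

(* kth_eigval M k is the k-th smallest eigenvalue (k = 1, 2, ...), counted with algebraic
   multiplicity, of a matrix M with real spectrum; Re only casts the eigenvalues to real. *)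
definition kth_eigval :: "complex mat \<Rightarrow> nat \<Rightarrow> real" where
  "kth_eigval M k = sorted_list_of_multiset (image_mset Re (proots (char_poly M))) ! (k - 1)"

definition second_distinct_eigval :: "complex mat \<Rightarrow> real" where
  "second_distinct_eigval M = Min {Re z | z. z \<in> spectrum M \<and> Re z > kth_eigval M 1}"

(* Orthonormality is with respect to the library's Hermitian inner product; indices start at 1. *)
definition orthonormal_eigvecs :: "nat \<Rightarrow> complex mat \<Rightarrow> (nat \<Rightarrow> complex Matrix.vec) \<Rightarrow> bool" where
  "orthonormal_eigvecs n M w \<longleftrightarrow>
    (\<forall>i\<in>{1..n}. w i \<in> carrier_vec n \<and> M *\<^sub>v w i = complex_of_real (kth_eigval M i) \<cdot>\<^sub>v w i) \<and>
    (\<forall>i\<in>{1..n}. \<forall>j\<in>{1..n}. w i \<bullet>c w j = (if i = j then 1 else 0))"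

definition cvec_norm :: "complex Matrix.vec \<Rightarrow> real" where
  "cvec_norm v = sqrt (\<Sum>i<dim_vec v. (cmod (vec_index v i))\<^sup>2)"

definition spectral_norm :: "complex mat \<Rightarrow> real" where
  "spectral_norm M =
    (SUP v\<in>{v \<in> carrier_vec (dim_col M). cvec_norm v \<le> 1}. cvec_norm (M *\<^sub>v v))"


section \<open>Subspaces of the space of complex N-vectors\<close>

definition cspan :: "nat \<Rightarrow> complex Matrix.vec set \<Rightarrow> complex Matrix.vec set" where
  "cspan N S = LinearCombinations.module.span class_ring (module_vec TYPE(complex) N) S"

(* Dimension of the subspace S, regarded as a vector space of its own. *)
definition cdim :: "nat \<Rightarrow> complex Matrix.vec set \<Rightarrow> nat" where
  "cdim N S = vectorspace.dim class_ring ((module_vec TYPE(complex) N)\<lparr>carrier := S\<rparr>)"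

definition orth_complement :: "nat \<Rightarrow> complex Matrix.vec set \<Rightarrow> complex Matrix.vec set" where
  "orth_complement N S = {v \<in> carrier_vec N. \<forall>u\<in>S. v \<bullet>c u = 0}"

definition is_onb_matrix :: "nat \<Rightarrow> complex mat \<Rightarrow> complex Matrix.vec set \<Rightarrow> bool" where
  "is_onb_matrix N B S \<longleftrightarrow>
    dim_row B = N \<and> mat_adjoint B * B = 1\<^sub>m (dim_col B) \<and> cspan N (set (cols B)) = S"


section \<open>The parameter-dependent matrix and its subspace projections\<close>

definition affine_mat ::
  "nat \<Rightarrow> nat \<Rightarrow> (nat \<Rightarrow> 'x \<Rightarrow> real) \<Rightarrow> (nat \<Rightarrow> complex mat) \<Rightarrow> 'x \<Rightarrow> complex mat" where
  "affine_mat N Q \<theta> Aq \<mu> =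
    Matrix.mat N N (\<lambda>(i, j). \<Sum>q=1..Q. complex_of_real (\<theta> q \<mu>) * index_mat (Aq q) (i, j))"

definition snapshot_space :: "nat \<Rightarrow> ('x \<Rightarrow> nat \<Rightarrow> complex Matrix.vec) \<Rightarrow> nat \<Rightarrow> (nat \<Rightarrow> 'x) \<Rightarrow> (nat \<Rightarrow> nat)
    \<Rightarrow> complex Matrix.vec set" where
  "snapshot_space N w J \<mu>s \<l> = cspan N {w (\<mu>s j) i | i j. j \<in> {1..J} \<and> i \<in> {1..\<l> j}}"

definition projected_mat :: "complex mat \<Rightarrow> complex mat \<Rightarrow> complex mat" where
  "projected_mat V M = mat_adjoint V * M * V"

definition ritz_mat :: "nat \<Rightarrow> complex mat \<Rightarrow> (nat \<Rightarrow> complex Matrix.vec) \<Rightarrow> nat \<Rightarrow> complex mat" where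
  "ritz_mat N V u s = mat_of_cols N (map (\<lambda>k. V *\<^sub>v u k) [1..<Suc s])"

definition residual :: "complex mat \<Rightarrow> complex mat \<Rightarrow> complex mat \<Rightarrow> real" where
  "residual M U Uperp = spectral_norm (mat_adjoint Uperp * M * U)"


section \<open>The lower bound\<close>

(* M = A(\<mu>\<^sub>j), w its eigenvectors, l = \<l>(j). *)
definition beta :: "nat \<Rightarrow> complex mat \<Rightarrow> (nat \<Rightarrow> complex Matrix.vec) \<Rightarrow> nat \<Rightarrow> complex mat \<Rightarrow> real" where
  "beta N M w l U =
    (let \<Lambda> = mat_diag l (\<lambda>i. complex_of_real (kth_eigval M (i + 1)));
         W = mat_of_cols N (map w [1..<Suc l])
     in kth_eigval
          ((\<Lambda> - complex_of_real (kth_eigval M 1) \<cdot>\<^sub>m 1\<^sub>m l)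
           - mat_adjoint W * U * mat_adjoint U * W
               * (\<Lambda> - complex_of_real (kth_eigval M (l + 1)) \<cdot>\<^sub>m 1\<^sub>m l))
          1)"

definition eig_box :: "nat \<Rightarrow> nat \<Rightarrow> (nat \<Rightarrow> complex mat) \<Rightarrow> (nat \<Rightarrow> real) set" where
  "eig_box N Q Aq = (\<Pi>\<^sub>E q\<in>{1..Q}. {kth_eigval (Aq q) 1 .. kth_eigval (Aq q) N})"

definition Y_LB :: "nat \<Rightarrow> nat \<Rightarrow> (nat \<Rightarrow> 'x \<Rightarrow> real) \<Rightarrow> (nat \<Rightarrow> complex mat)
    \<Rightarrow> ('x \<Rightarrow> nat \<Rightarrow> complex Matrix.vec) \<Rightarrow> nat \<Rightarrow> (nat \<Rightarrow> 'x) \<Rightarrow> (nat \<Rightarrow> nat) \<Rightarrow> complex mat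
    \<Rightarrow> (nat \<Rightarrow> real) set" where
  "Y_LB N Q \<theta> Aq w J \<mu>s \<l> U =
    {y \<in> eig_box N Q Aq. \<forall>j\<in>{1..J}.
       (\<Sum>q=1..Q. \<theta> q (\<mu>s j) * y q)
         \<ge> kth_eigval (affine_mat N Q \<theta> Aq (\<mu>s j)) 1
            + beta N (affine_mat N Q \<theta> Aq (\<mu>s j)) (w (\<mu>s j)) (\<l> j) U}"

(* Y_LB is a compact polytope, nonempty since s < N, so the infimum is the minimum. *)
definition eta_star :: "nat \<Rightarrow> (nat \<Rightarrow> 'x \<Rightarrow> real) \<Rightarrow> 'x \<Rightarrow> (nat \<Rightarrow> real) set \<Rightarrow> real" where
  "eta_star Q \<theta> \<mu> Y = (INF y\<in>Y. \<Sum>q=1..Q. \<theta> q \<mu> * y q)"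

definition gap :: "(nat \<Rightarrow> real) \<Rightarrow> nat \<Rightarrow> real \<Rightarrow> real" where
  "gap lamV k \<eta> = Min ((\<lambda>j. \<bar>\<eta> - lamV j\<bar>) ` {1..k})"

definition lambda_SLB :: "(nat \<Rightarrow> real) \<Rightarrow> real \<Rightarrow> real \<Rightarrow> nat \<Rightarrow> real" where
  "lambda_SLB lamV \<eta> \<rho> k =
    (if \<rho> = 0 \<and> gap lamV k \<eta> = 0 then min (lamV k) \<eta>
     else min (lamV k) \<eta> - 2 * \<rho>\<^sup>2 / (gap lamV k \<eta> + sqrt ((gap lamV k \<eta>)\<^sup>2 + 4 * \<rho>\<^sup>2)))"

end

theory Submission
  imports Defs
begin

text \<open>
  Let \<open>M = A(\<mu>)\<close>. The columns of \<open>U\<close> are Ritz vectors, so \<open>U\<^sup>* M U\<close> is diagonal with entries \<open>lamV 1, ..., lamV s\<close>,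
  and the coupling between the range of \<open>U\<close> and its orthogonal complement has norm \<open>\<rho>\<close>. The point is that \<open>\<eta>\<close>
  bounds \<open>M\<close> from below on the complement, so that \<open>M\<close> is compared with a two-block problem.

  For the bound on the complement, take a unit vector \<open>x\<close> orthogonal to \<open>U\<close> and put \<open>y\<^bsub>q\<^esub> = x\<^sup>* A\<^bsub>q\<^esub> x\<close>. Then
  \<open>\<theta>(\<nu>)\<^sup>T y = x\<^sup>* A(\<nu>) x\<close> for every \<open>\<nu>\<close>, and \<open>y\<close> is feasible for the linear program that defines \<open>\<eta>\<close>: it lies in the box
  by the Rayleigh bounds (lemma \<open>qform_bounds\<close>), and the constraint at \<open>\<mu>\<^bsub>j\<^esub>\<close> is lemma \<open>beta_lower_bound\<close>. The latter
  rests on the identity of the nonzero spectra of \<open>Y\<^sup>* (Y D)\<close> and \<open>(Y D) Y\<^sup>*\<close> (lemma \<open>gram_product_eigenvalue\<close>),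
  by which the eigenvalues of the non-Hermitian matrix in the definition of \<^const>\<open>beta\<close> are controlled by a
  Rayleigh quotient.

  For the comparison, Courant-Fischer provides a nonzero \<open>x\<close> in the span of the first \<open>k\<close> eigenvectors of \<open>M\<close>
  that is orthogonal to the first \<open>k - 1\<close> Ritz vectors (lemma \<open>low_energy_vector\<close>). Splitting \<open>x\<close> along \<open>U\<close> shows
  that \<open>\<lambda>\<^bsub>k\<^esub>(M)\<close> is at least the smaller eigenvalue of the matrix with diagonal \<open>lamV k, \<eta>\<close> and off-diagonal
  entries \<open>- \<rho>\<close> (lemma \<open>two_block_eigenvalue_bound\<close>). That eigenvalue is the claimed bound with \<open>\<bar>\<eta> - lamV k\<bar>\<close> in
  place of the gap, which is the minimum of such distances, and the bound increases with the gap.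
\<close>


section \<open>Inner product, norm and quadratic form of a matrix\<close>

definition qform :: "complex mat \<Rightarrow> complex Matrix.vec \<Rightarrow> real" where
  "qform M x = Re ((M *\<^sub>v x) \<bullet>c x)"

lemma mat_adjoint_carrier [simp, intro]:
  "A \<in> carrier_mat n m \<Longrightarrow> mat_adjoint A \<in> carrier_mat m n"
  unfolding mat_adjoint_def by auto

lemma mat_adjoint_dim [simp]:
  "dim_row (mat_adjoint A) = dim_col A" "dim_col (mat_adjoint A) = dim_row A"
  unfolding mat_adjoint_def by auto

lemma index_mat_adjoint [simp]:
  fixes A :: "complex mat"
  shows "i < dim_col A \<Longrightarrow> j < dim_row A \<Longrightarrow> index_mat (mat_adjoint A) (i, j) = cnj (index_mat A (j, i))"
  unfolding mat_adjoint_def by (simp add: mat_of_rows_index)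

lemma cscalar_prod_sum:
  fixes x y :: "complex Matrix.vec"
  assumes "y \<in> carrier_vec n"
  shows "x \<bullet>c y = (\<Sum>i<n. vec_index x i * cnj (vec_index y i))"
  using assms by (auto simp: scalar_prod_def atLeast0LessThan)

lemma index_mult_mat_vec_sum:
  assumes "A \<in> carrier_mat n m" "x \<in> carrier_vec m" "i < n"
  shows "vec_index (A *\<^sub>v x) i = (\<Sum>j<m. index_mat A (i, j) * vec_index x j)"
  using assms by (auto simp: scalar_prod_def atLeast0LessThan)

lemma cscalar_prod_adjoint:
  fixes A :: "complex mat"
  assumes A: "A \<in> carrier_mat n m" and x: "x \<in> carrier_vec m" and y: "y \<in> carrier_vec n"
  shows "(A *\<^sub>v x) \<bullet>c y = x \<bullet>c (mat_adjoint A *\<^sub>v y)"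
proof -
  have "(A *\<^sub>v x) \<bullet>c y = (\<Sum>i<n. \<Sum>j<m. index_mat A (i, j) * vec_index x j * cnj (vec_index y i))"
    by (simp add: cscalar_prod_sum[OF y] index_mult_mat_vec_sum[OF A x] sum_distrib_right)
  also have "\<dots> = (\<Sum>j<m. \<Sum>i<n. index_mat A (i, j) * vec_index x j * cnj (vec_index y i))"
    by (rule sum.swap)
  also have "\<dots> = (\<Sum>j<m. vec_index x j * cnj (vec_index (mat_adjoint A *\<^sub>v y) j))"
  proof (rule sum.cong, goal_cases)
    case (2 j)
    then have j: "j < m" by simp
    show ?case
      unfolding index_mult_mat_vec_sum[OF mat_adjoint_carrier[OF A] y j]
      using A j by (auto simp: sum_distrib_left intro!: sum.cong)
  qed simp
  also have "\<dots> = x \<bullet>c (mat_adjoint A *\<^sub>v y)"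
    by (rule cscalar_prod_sum[symmetric]) (use A y in \<open>auto intro!: mult_mat_vec_carrier[of _ m n]\<close>)
  finally show ?thesis .
qed

lemma mat_adjoint_mult:
  fixes A B :: "complex mat"
  assumes A: "A \<in> carrier_mat n m" and B: "B \<in> carrier_mat m k"
  shows "mat_adjoint (A * B) = mat_adjoint B * mat_adjoint A"
proof (rule eq_matI, goal_cases)
  case (1 i j)
  then have ij: "i < k" "j < n" using A B by auto
  then show ?case using A B
    by (auto simp: scalar_prod_def intro!: sum.cong)
qed (use A B in auto)

lemma mat_adjoint_minus:
  fixes A B :: "complex mat"
  assumes A: "A \<in> carrier_mat n m" and B: "B \<in> carrier_mat n m"
  shows "mat_adjoint (A - B) = mat_adjoint A - mat_adjoint B"
  using A B by (intro eq_matI) auto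

lemma mat_adjoint_adjoint [simp]:
  fixes A :: "complex mat"
  shows "mat_adjoint (mat_adjoint A) = A"
  by (rule eq_matI) auto

lemma cscalar_prod_commute:
  fixes x y :: "complex Matrix.vec"
  assumes "x \<in> carrier_vec n" "y \<in> carrier_vec n"
  shows "y \<bullet>c x = cnj (x \<bullet>c y)"
  by (simp add: cscalar_prod_sum[OF assms(1)] cscalar_prod_sum[OF assms(2)] mult.commute)

lemma cscalar_prod_add_left:
  fixes x y z :: "complex Matrix.vec"
  assumes "x \<in> carrier_vec n" "y \<in> carrier_vec n" "z \<in> carrier_vec n"
  shows "(x + y) \<bullet>c z = x \<bullet>c z + y \<bullet>c z"
  using assms by (intro add_scalar_prod_distrib[of _ n]) auto

lemma cscalar_prod_add_right:
  fixes x y z :: "complex Matrix.vec"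
  assumes "x \<in> carrier_vec n" "y \<in> carrier_vec n" "z \<in> carrier_vec n"
  shows "z \<bullet>c (x + y) = z \<bullet>c x + z \<bullet>c y"
  using assms by (subst (1 2 3) cscalar_prod_sum[of _ n]) (auto simp: algebra_simps sum.distrib)

lemma cscalar_prod_smult_left:
  fixes x y :: "complex Matrix.vec"
  assumes "x \<in> carrier_vec n" "y \<in> carrier_vec n"
  shows "(c \<cdot>\<^sub>v x) \<bullet>c y = c * (x \<bullet>c y)"
  using assms by (subst (1 2) cscalar_prod_sum[of _ n]) (auto simp: algebra_simps sum_distrib_left)

lemma cscalar_prod_smult_right:
  fixes x y :: "complex Matrix.vec"
  assumes "x \<in> carrier_vec n" "y \<in> carrier_vec n"
  shows "x \<bullet>c (c \<cdot>\<^sub>v y) = cnj c * (x \<bullet>c y)"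
  using assms by (subst (1 2) cscalar_prod_sum[of _ n]) (auto simp: algebra_simps sum_distrib_left)

lemma cvec_norm_sq: "(cvec_norm x)\<^sup>2 = (\<Sum>i<dim_vec x. (cmod (vec_index x i))\<^sup>2)"
  unfolding cvec_norm_def by (simp add: sum_nonneg)

lemma cvec_norm_nonneg [simp]: "0 \<le> cvec_norm x"
  unfolding cvec_norm_def by (simp add: sum_nonneg)

lemma cscalar_prod_self: "x \<bullet>c x = complex_of_real ((cvec_norm x)\<^sup>2)"
  by (subst cscalar_prod_sum[of _ "dim_vec x"])
     (auto simp: cvec_norm_sq complex_norm_square[symmetric] simp flip: of_real_power)

lemma cvec_norm_eq_0:
  assumes "x \<in> carrier_vec n" "cvec_norm x = 0"
  shows "x = 0\<^sub>v n"
proof -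
  have "(\<Sum>i<n. (cmod (vec_index x i))\<^sup>2) = 0"
    using assms cvec_norm_sq[of x] by simp
  then have "\<forall>i<n. vec_index x i = 0"
    by (subst (asm) sum_nonneg_eq_0_iff) auto
  then show ?thesis using assms by (intro eq_vecI) auto
qed

lemma cvec_norm_smult: "cvec_norm (c \<cdot>\<^sub>v x) = cmod c * cvec_norm x"
proof -
  have "(cvec_norm (c \<cdot>\<^sub>v x))\<^sup>2 = (cmod c * cvec_norm x)\<^sup>2"
    by (simp add: cvec_norm_sq norm_mult power_mult_distrib sum_distrib_left)
  then show ?thesis by (simp add: power2_eq_iff_nonneg)
qed

lemma cscalar_prod_Cauchy_Schwarz:
  fixes x y :: "complex Matrix.vec"
  assumes x: "x \<in> carrier_vec n" and y: "y \<in> carrier_vec n"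
  shows "cmod (x \<bullet>c y) \<le> cvec_norm x * cvec_norm y"
proof -
  have "cmod (x \<bullet>c y) \<le> (\<Sum>i<n. cmod (vec_index x i) * cmod (vec_index y i))"
    unfolding cscalar_prod_sum[OF y] by (rule sum_norm_le) (simp add: norm_mult)
  moreover have "(\<Sum>i<n. cmod (vec_index x i) * cmod (vec_index y i))\<^sup>2 \<le> (cvec_norm x * cvec_norm y)\<^sup>2"
    using Cauchy_Schwarz_ineq_sum[of "\<lambda>i. cmod (vec_index x i)" "\<lambda>i. cmod (vec_index y i)" "{..<n}"]
      x y by (simp add: cvec_norm_sq power_mult_distrib)
  then have "(\<Sum>i<n. cmod (vec_index x i) * cmod (vec_index y i)) \<le> cvec_norm x * cvec_norm y"
    by (rule power2_le_imp_le) simp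
  ultimately show ?thesis by linarith
qed

lemma hermitian_cscalar_prod:
  assumes "H \<in> carrier_mat n n" "hermitian H" "x \<in> carrier_vec n" "y \<in> carrier_vec n"
  shows "(H *\<^sub>v x) \<bullet>c y = x \<bullet>c (H *\<^sub>v y)"
  using cscalar_prod_adjoint[OF assms(1,3,4)] assms(2) unfolding hermitian_def by simp

lemma qform_smult:
  assumes H: "H \<in> carrier_mat n n" and x: "x \<in> carrier_vec n"
  shows "qform H (c \<cdot>\<^sub>v x) = (cmod c)\<^sup>2 * qform H x"
proof -
  have "(H *\<^sub>v (c \<cdot>\<^sub>v x)) \<bullet>c (c \<cdot>\<^sub>v x) = c * (cnj c * ((H *\<^sub>v x) \<bullet>c x))"
    using H x by (simp add: mult_mat_vec[OF H x] cscalar_prod_smult_left[of _ n] cscalar_prod_smult_right[of _ n])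
  also have "\<dots> = complex_of_real ((cmod c)\<^sup>2) * ((H *\<^sub>v x) \<bullet>c x)"
    unfolding complex_norm_square by (simp add: mult.assoc)
  finally show ?thesis unfolding qform_def by simp
qed

lemma qform_add:
  assumes H: "H \<in> carrier_mat n n" and h: "hermitian H"
    and x: "x \<in> carrier_vec n" and y: "y \<in> carrier_vec n"
  shows "qform H (x + y) = qform H x + 2 * Re ((H *\<^sub>v x) \<bullet>c y) + qform H y"
proof -
  have "(H *\<^sub>v y) \<bullet>c x = cnj ((H *\<^sub>v x) \<bullet>c y)"
    using hermitian_cscalar_prod[OF H h y x] cscalar_prod_commute[of "H *\<^sub>v x" n y] H x y by simp
  then show ?thesis unfolding qform_def
    using H x y by (simp add: mult_add_distrib_mat_vec[OF H x y] cscalar_prod_add_left[of _ n]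
        cscalar_prod_add_right[of _ n])
qed

text \<open>A positive semidefinite form that vanishes at \<open>x\<close> is minimal there, so it cannot decrease in the
  direction \<open>- H x\<close>; its first variation in that direction is \<open>- 2 \<parallel>H x\<parallel>\<^sup>2\<close>.\<close>

lemma psd_qform_zero:
  assumes H: "H \<in> carrier_mat n n" and h: "hermitian H"
    and psd: "\<And>x. x \<in> carrier_vec n \<Longrightarrow> 0 \<le> qform H x"
    and x: "x \<in> carrier_vec n" and 0: "qform H x = 0"
  shows "H *\<^sub>v x = 0\<^sub>v n"
proof -
  define z where "z = H *\<^sub>v x"
  have z: "z \<in> carrier_vec n" using H x unfolding z_def by simp
  \<comment> \<open>Any step below \<open>2 \<parallel>z\<parallel>\<^sup>2 / qform H z\<close> makes the form negative unless \<open>z = 0\<close>; the added 1 avoids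
    a zero denominator.\<close>
  define t where "t = (cvec_norm z)\<^sup>2 / (qform H z + 1)"
  have pos: "qform H z + 1 > 0" using psd[OF z] by linarith
  have "0 \<le> qform H (x + complex_of_real (- t) \<cdot>\<^sub>v z)"
    by (rule psd) (use x z in auto)
  also have "\<dots> = - 2 * t * (cvec_norm z)\<^sup>2 + t\<^sup>2 * qform H z"
    using z 0 by (simp add: qform_add[OF H h x] qform_smult[OF H z] cscalar_prod_smult_right[of _ n]
        flip: z_def) (simp add: cscalar_prod_self)
  finally have "2 * t * (t * (qform H z + 1)) \<le> t\<^sup>2 * qform H z"
    using pos by (simp add: t_def)
  then have "t\<^sup>2 * (qform H z + 2) \<le> 0" by (simp add: power2_eq_square algebra_simps)
  moreover have "qform H z + 2 > 0" using pos by linarith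
  ultimately have "t = 0"
    by (smt (verit) mult_pos_pos zero_less_power2)
  then have "cvec_norm z = 0" using pos unfolding t_def by simp
  then show ?thesis using cvec_norm_eq_0[OF z] unfolding z_def by simp
qed


section \<open>Eigenvalues\<close>

lemma eigenvalue_carrier_iff:
  assumes "A \<in> carrier_mat n n"
  shows "eigenvalue A k \<longleftrightarrow> (\<exists>v\<in>carrier_vec n. v \<noteq> 0\<^sub>v n \<and> A *\<^sub>v v = k \<cdot>\<^sub>v v)"
  unfolding eigenvalue_def eigenvector_def carrier_matD(1)[OF assms] by auto

lemma length_sorted_eigvals:
  assumes "M \<in> carrier_mat n n"
  shows "length (sorted_list_of_multiset (image_mset Re (proots (char_poly M)))) = n"
  using degree_monic_char_poly[OF assms]
  by (metis mset_sorted_list_of_multiset size_image_mset size_mset size_proots_complex)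

lemma kth_eigval_mono:
  assumes "M \<in> carrier_mat n n" "1 \<le> i" "i \<le> j" "j \<le> n"
  shows "kth_eigval M i \<le> kth_eigval M j"
  unfolding kth_eigval_def
  by (rule sorted_nth_mono) (use assms length_sorted_eigvals[OF assms(1)] in auto)

lemma eigenvalue_bounds:
  assumes M: "M \<in> carrier_mat n n" and ev: "eigenvalue M z"
  shows "kth_eigval M 1 \<le> Re z" "Re z \<le> kth_eigval M n"
proof -
  let ?xs = "sorted_list_of_multiset (image_mset Re (proots (char_poly M)))"
  have "char_poly M \<noteq> 0" using degree_monic_char_poly[OF M] by auto
  then have "z \<in># proots (char_poly M)"
    using ev eigenvalue_root_char_poly[OF M] by simp
  then have "Re z \<in> set ?xs" by simp
  then obtain i where i: "i < n" "?xs ! i = Re z"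
    using length_sorted_eigvals[OF M] by (metis in_set_conv_nth)
  have "kth_eigval M (Suc i) = Re z" using i by (simp add: kth_eigval_def)
  then show "kth_eigval M 1 \<le> Re z" "Re z \<le> kth_eigval M n"
    using kth_eigval_mono[OF M, of 1 "Suc i"] kth_eigval_mono[OF M, of "Suc i" n] i by auto
qed

lemma qform_eq_sum:
  assumes H: "H \<in> carrier_mat n n" and x: "x \<in> carrier_vec n"
  shows "qform H x = Re (\<Sum>i<n. (\<Sum>j<n. index_mat H (i, j) * vec_index x j) * cnj (vec_index x i))"
  unfolding qform_def cscalar_prod_sum[OF x] using index_mult_mat_vec_sum[OF H x] by simp

text \<open>Compactness of the unit sphere of \<open>\<complex>\<^sup>n\<close>. Since \<open>n\<close> is not a type, the sphere is realised as a closed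
  subset of a product of unit discs indexed by all natural numbers, with the coordinates from \<open>n\<close> on
  equal to zero, and compactness comes from Tychonoff's theorem.\<close>

lemma qform_maximizer:
  assumes H: "H \<in> carrier_mat n n" and n: "0 < n"
  obtains x where "x \<in> carrier_vec n" "cvec_norm x = 1"
    "\<And>y. y \<in> carrier_vec n \<Longrightarrow> cvec_norm y = 1 \<Longrightarrow> qform H y \<le> qform H x"
proof -
  define S where "S = {f :: nat \<Rightarrow> complex. (\<Sum>i<n. (cmod (f i))\<^sup>2) = 1 \<and> (\<forall>i\<ge>n. f i = 0)}"
  define q where "q = (\<lambda>f :: nat \<Rightarrow> complex. Re (\<Sum>i<n. (\<Sum>j<n. index_mat H (i, j) * f j) * cnj (f i)))"
  have coord: "continuous_on T (\<lambda>f :: nat \<Rightarrow> complex. f i)" for T i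
    by (rule continuous_on_subset[OF continuous_on_product_coordinates]) simp
  have "closed S"
  proof -
    have "S = {f. (\<Sum>i<n. (cmod (f i))\<^sup>2) = 1} \<inter> (\<Inter>i\<in>{n..}. {f. f i = 0})"
      unfolding S_def by auto
    moreover have "closed {f :: nat \<Rightarrow> complex. (\<Sum>i<n. (cmod (f i))\<^sup>2) = 1}"
      by (intro closed_Collect_eq continuous_intros coord)
    moreover have "closed {f :: nat \<Rightarrow> complex. f i = 0}" for i
      by (intro closed_Collect_eq continuous_intros coord)
    ultimately show ?thesis by auto
  qed
  moreover have "compact (PiE UNIV (\<lambda>_ :: nat. cball (0 :: complex) 1))"
    using compactin_PiE[of "\<lambda>_ :: nat. euclidean :: complex topology" UNIV "\<lambda>_. cball 0 1"]
    by (simp add: euclidean_product_topology)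
  moreover have "S \<subseteq> PiE UNIV (\<lambda>_ :: nat. cball (0 :: complex) 1)"
  proof
    fix f assume f: "f \<in> S"
    have "cmod (f i) \<le> 1" for i
    proof (cases "i < n")
      case True
      then have "(cmod (f i))\<^sup>2 \<le> (\<Sum>i<n. (cmod (f i))\<^sup>2)"
        by (intro member_le_sum) auto
      then have "(cmod (f i))\<^sup>2 \<le> 1\<^sup>2" using f by (simp add: S_def)
      then show ?thesis by (rule power2_le_imp_le) simp
    qed (use f in \<open>auto simp: S_def\<close>)
    then show "f \<in> PiE UNIV (\<lambda>_. cball 0 1)" by auto
  qed
  ultimately have "compact S"
    using compact_Int_closed[of "PiE UNIV (\<lambda>_ :: nat. cball (0 :: complex) 1)" S]
    by (simp add: Int_absorb1)
  moreover have "(\<lambda>i. if i = 0 then 1 else 0) \<in> S"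
    unfolding S_def using n by (auto simp: if_distrib[of cmod] if_distrib[of "\<lambda>z. z\<^sup>2"] cong: if_cong)
  then have "S \<noteq> {}" by blast
  moreover have "continuous_on S q"
    unfolding q_def by (intro continuous_intros coord)
  ultimately obtain f where f: "f \<in> S" and max: "\<And>g. g \<in> S \<Longrightarrow> q g \<le> q f"
    using continuous_attains_sup[of S q] by blast
  let ?x = "Matrix.vec n f"
  have q: "qform H y = q (\<lambda>i. if i < n then vec_index y i else 0)" if "y \<in> carrier_vec n" for y
    unfolding qform_eq_sum[OF H that] q_def by (intro arg_cong[of _ _ Re] sum.cong) auto
  show thesis
  proof (rule that[of ?x])
    have "(cvec_norm ?x)\<^sup>2 = 1" using f by (simp add: cvec_norm_sq S_def)
    then show "cvec_norm ?x = 1" by (simp add: power2_eq_1_iff) (smt (verit) cvec_norm_nonneg)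
  next
    fix y :: "complex Matrix.vec" assume y: "y \<in> carrier_vec n" "cvec_norm y = 1"
    have "(\<lambda>i. if i < n then vec_index y i else 0) \<in> S"
      using y cvec_norm_sq[of y] by (simp add: S_def)
    from max[OF this] have "qform H y \<le> q f" unfolding q[OF y(1)] .
    also have "(\<lambda>i. if i < n then vec_index ?x i else 0) = f"
      using f by (auto simp: S_def)
    then have "q f = qform H ?x" using q[of ?x] by simp
    finally show "qform H y \<le> qform H ?x" .
  qed simp
qed

lemma unit_vector_scaling:
  assumes x: "x \<in> carrier_vec n" and "cvec_norm x \<noteq> 0"
  obtains y where "y \<in> carrier_vec n" "cvec_norm y = 1" "x = complex_of_real (cvec_norm x) \<cdot>\<^sub>v y"
proof
  let ?y = "complex_of_real (1 / cvec_norm x) \<cdot>\<^sub>v x"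
  show "?y \<in> carrier_vec n" using x by simp
  show "cvec_norm ?y = 1" using assms(2) by (simp add: cvec_norm_smult norm_divide)
  show "x = complex_of_real (cvec_norm x) \<cdot>\<^sub>v ?y"
    using assms(2) by (simp add: smult_smult_assoc)
qed

lemma qform_le_scale:
  assumes H: "H \<in> carrier_mat n n" and x: "x \<in> carrier_vec n"
    and unit: "\<And>y. y \<in> carrier_vec n \<Longrightarrow> cvec_norm y = 1 \<Longrightarrow> qform H y \<le> c"
  shows "qform H x \<le> c * (cvec_norm x)\<^sup>2"
proof (cases "cvec_norm x = 0")
  case True
  then have "x = 0\<^sub>v n" using cvec_norm_eq_0[OF x] by simp
  then show ?thesis using True H by (simp add: qform_def)
next
  case False
  then obtain y where y: "y \<in> carrier_vec n" "cvec_norm y = 1" "x = complex_of_real (cvec_norm x) \<cdot>\<^sub>v y"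
    using unit_vector_scaling[OF x] by blast
  have "qform H x = (cvec_norm x)\<^sup>2 * qform H y"
    using qform_smult[OF H y(1), of "complex_of_real (cvec_norm x)"] y(3) by simp
  then show ?thesis using unit[OF y(1,2)] by (simp add: mult.commute[of _ "(cvec_norm x)\<^sup>2"] mult_left_mono)
qed

lemma smult_mat_mult_vec:
  assumes "A \<in> carrier_mat n m" "x \<in> carrier_vec m"
  shows "(c \<cdot>\<^sub>m A) *\<^sub>v x = c \<cdot>\<^sub>v (A *\<^sub>v x)"
  using assms by (intro eq_vecI) (auto intro!: smult_scalar_prod_distrib[of _ m])

lemma qform_smult_one_minus:
  assumes H: "H \<in> carrier_mat n n" and x: "x \<in> carrier_vec n"
  shows "qform (complex_of_real c \<cdot>\<^sub>m 1\<^sub>m n - H) x = c * (cvec_norm x)\<^sup>2 - qform H x"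
proof -
  have 1: "(complex_of_real c \<cdot>\<^sub>m 1\<^sub>m n - H) *\<^sub>v x = complex_of_real c \<cdot>\<^sub>v x + (- 1) \<cdot>\<^sub>v (H *\<^sub>v x)"
    using H x by (subst minus_mult_distrib_mat_vec[of _ n n]) (auto simp: smult_mat_mult_vec[of _ n n])
  show ?thesis unfolding qform_def 1 using H x
    by (subst cscalar_prod_add_left[of _ n]) (auto simp: cscalar_prod_smult_left[of _ n] cscalar_prod_self
        simp flip: of_real_power)
qed

lemma hermitian_smult_one_minus:
  assumes H: "H \<in> carrier_mat n n" and h: "hermitian H"
  shows "hermitian (complex_of_real c \<cdot>\<^sub>m 1\<^sub>m n - H)"
proof -
  have "cnj (index_mat H (j, i)) = index_mat H (i, j)" if "i < n" "j < n" for i j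
    using h index_mat_adjoint[of i H j] H that unfolding hermitian_def by auto
  then show ?thesis
    unfolding hermitian_def by (intro eq_matI) (use H in auto)
qed

text \<open>A maximizer of the Rayleigh quotient is an eigenvector: if \<open>\<kappa>\<close> is the maximum, \<open>\<kappa> I - H\<close> is positive
  semidefinite and its form vanishes at the maximizer. This is the only part of the spectral theorem
  that the matrices without prescribed eigenvectors require.\<close>

lemma hermitian_top_eigenvalue:
  assumes H: "H \<in> carrier_mat n n" and h: "hermitian H" and n: "0 < n"
  obtains \<kappa> :: real where "eigenvalue H (complex_of_real \<kappa>)"
    "\<And>x. x \<in> carrier_vec n \<Longrightarrow> qform H x \<le> \<kappa> * (cvec_norm x)\<^sup>2"
proof -
  from qform_maximizer[OF H n] obtain v where v: "v \<in> carrier_vec n" "cvec_norm v = 1"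
    and max: "\<And>y. y \<in> carrier_vec n \<Longrightarrow> cvec_norm y = 1 \<Longrightarrow> qform H y \<le> qform H v" by blast
  define \<kappa> where "\<kappa> = qform H v"
  define B where "B = complex_of_real \<kappa> \<cdot>\<^sub>m 1\<^sub>m n - H"
  have B: "B \<in> carrier_mat n n" unfolding B_def using H by (intro minus_carrier_mat)
  have le: "qform H x \<le> \<kappa> * (cvec_norm x)\<^sup>2" if "x \<in> carrier_vec n" for x
    using qform_le_scale[OF H that] max unfolding \<kappa>_def by blast
  have hB: "hermitian B" unfolding B_def by (rule hermitian_smult_one_minus[OF H h])
  have "B *\<^sub>v v = 0\<^sub>v n"
    by (rule psd_qform_zero[OF B hB _ v(1)])
       (use le v in \<open>auto simp: B_def qform_smult_one_minus[OF H] \<kappa>_def\<close>)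
  then have eq: "complex_of_real \<kappa> \<cdot>\<^sub>v v - H *\<^sub>v v = 0\<^sub>v n"
    unfolding B_def using H v by (subst (asm) minus_mult_distrib_mat_vec[of _ n n]) (auto simp: smult_mat_mult_vec[of _ n n])
  have "H *\<^sub>v v = complex_of_real \<kappa> \<cdot>\<^sub>v v"
  proof (rule eq_vecI, goal_cases)
    case (1 i)
    then have "vec_index (complex_of_real \<kappa> \<cdot>\<^sub>v v - H *\<^sub>v v) i = 0" using eq v by simp
    then show ?case using 1 v H by simp
  qed (use H v in auto)
  moreover have "v \<noteq> 0\<^sub>v n" using v by (auto simp: cvec_norm_def)
  ultimately have "eigenvalue H (complex_of_real \<kappa>)"
    unfolding eigenvalue_carrier_iff[OF H] using v by auto
  then show thesis using le that by blast
qed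

text \<open>The maximum of the Rayleigh quotient is attained at an eigenvalue, which is at most the largest one; the
  lower bound is the upper bound for \<open>- H\<close>.\<close>

lemma qform_bounds:
  assumes H: "H \<in> carrier_mat n n" and h: "hermitian H" and n: "0 < n" and x: "x \<in> carrier_vec n"
  shows "qform H x \<le> kth_eigval H n * (cvec_norm x)\<^sup>2"
    and "kth_eigval H 1 * (cvec_norm x)\<^sup>2 \<le> qform H x"
proof -
  from hermitian_top_eigenvalue[OF H h n] obtain \<kappa> where \<kappa>: "eigenvalue H (complex_of_real \<kappa>)"
    and le: "\<And>x. x \<in> carrier_vec n \<Longrightarrow> qform H x \<le> \<kappa> * (cvec_norm x)\<^sup>2" by blast
  have "\<kappa> \<le> kth_eigval H n" using eigenvalue_bounds(2)[OF H \<kappa>] by simp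
  then show "qform H x \<le> kth_eigval H n * (cvec_norm x)\<^sup>2"
    using le[OF x] by (meson mult_right_mono order_trans zero_le_power2)
  \<comment> \<open>\<open>- H\<close>, written as a shift so that the facts on \<open>c I - H\<close> apply.\<close>
  define B where "B = complex_of_real 0 \<cdot>\<^sub>m 1\<^sub>m n - H"
  have B: "B \<in> carrier_mat n n" unfolding B_def using H by (intro minus_carrier_mat)
  have hB: "hermitian B" unfolding B_def by (rule hermitian_smult_one_minus[OF H h])
  from hermitian_top_eigenvalue[OF B hB n] obtain \<nu> where \<nu>: "eigenvalue B (complex_of_real \<nu>)"
    and le': "\<And>x. x \<in> carrier_vec n \<Longrightarrow> qform B x \<le> \<nu> * (cvec_norm x)\<^sup>2" by blast
  from \<nu> obtain v where v: "v \<in> carrier_vec n" "v \<noteq> 0\<^sub>v n" "B *\<^sub>v v = complex_of_real \<nu> \<cdot>\<^sub>v v"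
    unfolding eigenvalue_carrier_iff[OF B] by auto
  have "H *\<^sub>v v = complex_of_real (- \<nu>) \<cdot>\<^sub>v v"
  proof (rule eq_vecI, goal_cases)
    case (1 i)
    then have "vec_index (B *\<^sub>v v) i = complex_of_real \<nu> * vec_index v i" using v by simp
    moreover have "B *\<^sub>v v = 0\<^sub>v n - H *\<^sub>v v"
      unfolding B_def using H v by (subst minus_mult_distrib_mat_vec[of _ n n]) (auto simp: smult_mat_mult_vec[of _ n n])
    ultimately have "- vec_index (H *\<^sub>v v) i = complex_of_real \<nu> * vec_index v i" using 1 v H by simp
    then show ?case using 1 v H by (metis index_smult_vec(1) index_smult_vec(2) minus_minus mult_minus_left of_real_minus)
  qed (use H v in auto)
  then have "eigenvalue H (complex_of_real (- \<nu>))"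
    unfolding eigenvalue_carrier_iff[OF H] using v by auto
  then have "kth_eigval H 1 \<le> - \<nu>" using eigenvalue_bounds(1)[OF H] by fastforce
  moreover have "- qform H x \<le> \<nu> * (cvec_norm x)\<^sup>2"
    using le'[OF x] unfolding B_def qform_smult_one_minus[OF H x] by simp
  ultimately show "kth_eigval H 1 * (cvec_norm x)\<^sup>2 \<le> qform H x"
    using mult_right_mono[of "kth_eigval H 1" "- \<nu>" "(cvec_norm x)\<^sup>2"] by simp
qed


section \<open>Orthonormal frames\<close>

lemma mat_of_cols_map_carrier [simp, intro]:
  "mat_of_cols N (map p [1..<Suc l]) \<in> carrier_mat N l"
  by (intro carrier_matI) auto

lemma col_mat_of_cols_map:
  assumes "\<And>k. k \<in> {1..l} \<Longrightarrow> p k \<in> carrier_vec N" "i < l"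
  shows "Matrix.col (mat_of_cols N (map p [1..<Suc l])) i = p (Suc i)"
  using assms by (subst col_mat_of_cols) (auto simp del: upt_Suc)

lemma index_adjoint_mult_vec:
  fixes X :: "complex mat"
  assumes "X \<in> carrier_mat N l" "x \<in> carrier_vec N" "i < l"
  shows "vec_index (mat_adjoint X *\<^sub>v x) i = x \<bullet>c Matrix.col X i"
  using assms by (auto simp: scalar_prod_def mult.commute intro!: sum.cong)

lemma index_adjoint_mult_mat:
  fixes X Y :: "complex mat"
  assumes "X \<in> carrier_mat N l" "Y \<in> carrier_mat N m" "i < l" "j < m"
  shows "index_mat (mat_adjoint X * Y) (i, j) = Matrix.col Y j \<bullet>c Matrix.col X i"
  using assms by (auto simp: scalar_prod_def mult.commute intro!: sum.cong)

lemma adjoint_mult_orthonormal_cols: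
  fixes p :: "nat \<Rightarrow> complex Matrix.vec"
  assumes p: "\<And>k. k \<in> {1..l} \<Longrightarrow> p k \<in> carrier_vec N"
    and on: "\<And>i j. i \<in> {1..l} \<Longrightarrow> j \<in> {1..l} \<Longrightarrow> p i \<bullet>c p j = (if i = j then 1 else 0)"
  shows "mat_adjoint (mat_of_cols N (map p [1..<Suc l])) * mat_of_cols N (map p [1..<Suc l]) = 1\<^sub>m l"
    (is "mat_adjoint ?X * ?X = _")
proof (rule eq_matI, goal_cases)
  case (1 i j)
  then have ij: "i < l" "j < l" by auto
  have "index_mat (mat_adjoint ?X * ?X) (i, j) = Matrix.col ?X j \<bullet>c Matrix.col ?X i"
    by (rule index_adjoint_mult_mat) (use ij mat_of_cols_map_carrier in \<open>auto simp del: upt_Suc\<close>)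
  also have "\<dots> = p (Suc j) \<bullet>c p (Suc i)"
    using ij by (simp only: col_mat_of_cols_map[of l p N, OF p])
  finally show ?case using ij on[of "Suc j" "Suc i"] by simp
qed (auto simp del: upt_Suc)

text \<open>A square matrix with a left inverse has it as right inverse too, so \<open>n\<close> orthonormal vectors in
  \<open>\<complex>\<^sup>n\<close> satisfy Parseval's identity.\<close>

lemma onb_expansion:
  assumes w: "\<And>k. k \<in> {1..n} \<Longrightarrow> w k \<in> carrier_vec n"
    and on: "\<And>i j. i \<in> {1..n} \<Longrightarrow> j \<in> {1..n} \<Longrightarrow> w i \<bullet>c w j = (if i = j then 1 else 0)"
    and x: "x \<in> carrier_vec n" and y: "y \<in> carrier_vec n"
  shows "x \<bullet>c y = (\<Sum>i=1..n. (x \<bullet>c w i) * cnj (y \<bullet>c w i))"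
proof -
  define W where "W = mat_of_cols n (map w [1..<Suc n])"
  have W: "W \<in> carrier_mat n n" unfolding W_def by (rule mat_of_cols_map_carrier)
  have "mat_adjoint W * W = 1\<^sub>m n"
    unfolding W_def by (rule adjoint_mult_orthonormal_cols) (use w on in auto)
  then have WW: "W * mat_adjoint W = 1\<^sub>m n"
    using mat_mult_left_right_inverse[of "mat_adjoint W" n W] W by auto
  have c: "vec_index (mat_adjoint W *\<^sub>v z) i = z \<bullet>c w (Suc i)" if "z \<in> carrier_vec n" "i < n" for z i
    using index_adjoint_mult_vec[OF W that] col_mat_of_cols_map[of n w n i] w that by (simp add: W_def)
  have "(mat_adjoint W *\<^sub>v x) \<bullet>c (mat_adjoint W *\<^sub>v y) = x \<bullet>c (W *\<^sub>v (mat_adjoint W *\<^sub>v y))"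
    using cscalar_prod_adjoint[of "mat_adjoint W" n n x "mat_adjoint W *\<^sub>v y"] W x y
    by (auto intro!: mult_mat_vec_carrier[of _ n n])
  also have "W *\<^sub>v (mat_adjoint W *\<^sub>v y) = y"
    using assoc_mult_mat_vec[of W n n "mat_adjoint W" n y] W y WW by auto
  finally have "x \<bullet>c y = (mat_adjoint W *\<^sub>v x) \<bullet>c (mat_adjoint W *\<^sub>v y)" by simp
  also have "\<dots> = (\<Sum>i<n. (x \<bullet>c w (Suc i)) * cnj (y \<bullet>c w (Suc i)))"
    by (subst cscalar_prod_sum[of _ n]) (use W x y c in \<open>auto intro!: mult_mat_vec_carrier[of _ n n]\<close>)
  also have "\<dots> = (\<Sum>i=1..n. (x \<bullet>c w i) * cnj (y \<bullet>c w i))"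
    using sum.shift_bounds_Suc_ivl[of "\<lambda>i. (x \<bullet>c w i) * cnj (y \<bullet>c w i)" 0 n]
    by (simp add: atLeast0LessThan atLeastLessThanSuc_atLeastAtMost)
  finally show ?thesis .
qed

lemma eigvecs_expansion:
  assumes M: "M \<in> carrier_mat n n" and h: "hermitian M" and w: "orthonormal_eigvecs n M w"
    and x: "x \<in> carrier_vec n"
  shows "(cvec_norm x)\<^sup>2 = (\<Sum>i=1..n. (cmod (x \<bullet>c w i))\<^sup>2)"
    and "qform M x = (\<Sum>i=1..n. kth_eigval M i * (cmod (x \<bullet>c w i))\<^sup>2)"
proof -
  have wc: "w k \<in> carrier_vec n" and ev: "M *\<^sub>v w k = complex_of_real (kth_eigval M k) \<cdot>\<^sub>v w k"
    if "k \<in> {1..n}" for k using w that unfolding orthonormal_eigvecs_def by auto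
  have on: "w i \<bullet>c w j = (if i = j then 1 else 0)" if "i \<in> {1..n}" "j \<in> {1..n}" for i j
    using w that unfolding orthonormal_eigvecs_def by auto
  have expand: "y \<bullet>c z = (\<Sum>i=1..n. (y \<bullet>c w i) * cnj (z \<bullet>c w i))"
    if "y \<in> carrier_vec n" "z \<in> carrier_vec n" for y z
    using onb_expansion[of n w y z] wc on that by blast
  have "complex_of_real ((cvec_norm x)\<^sup>2) = complex_of_real (\<Sum>i=1..n. (cmod (x \<bullet>c w i))\<^sup>2)"
    unfolding cscalar_prod_self[symmetric] expand[OF x x] of_real_sum complex_norm_square by (rule refl)
  then show "(cvec_norm x)\<^sup>2 = (\<Sum>i=1..n. (cmod (x \<bullet>c w i))\<^sup>2)" by (simp only: of_real_eq_iff)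
  have Mx: "M *\<^sub>v x \<in> carrier_vec n" using M x by simp
  have c: "(M *\<^sub>v x) \<bullet>c w i = complex_of_real (kth_eigval M i) * (x \<bullet>c w i)" if "i \<in> {1..n}" for i
    unfolding hermitian_cscalar_prod[OF M h x wc[OF that]] ev[OF that]
    using cscalar_prod_smult_right[OF x wc[OF that]] by simp
  have "(M *\<^sub>v x) \<bullet>c x = (\<Sum>i=1..n. complex_of_real (kth_eigval M i * (cmod (x \<bullet>c w i))\<^sup>2))"
    unfolding expand[OF Mx x] of_real_mult complex_norm_square
    by (intro sum.cong refl) (simp add: c)
  then show "qform M x = (\<Sum>i=1..n. kth_eigval M i * (cmod (x \<bullet>c w i))\<^sup>2)"
    unfolding qform_def by simp
qed

lemma mult_mat_zero_vec:
  "A \<in> carrier_mat n m \<Longrightarrow> A *\<^sub>v 0\<^sub>v m = 0\<^sub>v n"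
  by (intro eq_vecI) auto

lemma congruence_mult_vec:
  fixes Y :: "complex mat"
  assumes Y: "Y \<in> carrier_mat N l" and D: "D \<in> carrier_mat l l" and x: "x \<in> carrier_vec N"
  shows "(Y * D * mat_adjoint Y) *\<^sub>v x = Y *\<^sub>v (D *\<^sub>v (mat_adjoint Y *\<^sub>v x))"
  using assoc_mult_mat_vec[OF mult_carrier_mat[OF Y D] mat_adjoint_carrier[OF Y] x]
    assoc_mult_mat_vec[OF Y D mult_mat_vec_carrier[OF mat_adjoint_carrier[OF Y] x]] by simp

lemma qform_congruence:
  assumes Y: "Y \<in> carrier_mat N l" and D: "D \<in> carrier_mat l l" and x: "x \<in> carrier_vec N"
  shows "qform (Y * D * mat_adjoint Y) x = qform D (mat_adjoint Y *\<^sub>v x)"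
proof -
  have y: "mat_adjoint Y *\<^sub>v x \<in> carrier_vec l" using Y x by (intro mult_mat_vec_carrier[of _ l N]) auto
  show ?thesis unfolding qform_def congruence_mult_vec[OF assms]
    using cscalar_prod_adjoint[OF Y _ x, of "D *\<^sub>v (mat_adjoint Y *\<^sub>v x)"] D y by simp
qed

text \<open>The products \<open>Y\<^sup>* (Y D)\<close> and \<open>(Y D) Y\<^sup>*\<close> have the same nonzero eigenvalues. The second one is Hermitian,
  so its largest eigenvalue \<open>\<kappa>\<close> dominates \<open>qform D (Y\<^sup>* x) / \<parallel>x\<parallel>\<^sup>2\<close>; if \<open>\<kappa> > 0\<close>, it is an eigenvalue of the
  first one, although that matrix is in general not Hermitian. If \<open>\<kappa> \<le> 0\<close>, any eigenvalue of the first
  matrix will do, because the real part of none of them is negative.\<close>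

lemma gram_product_eigenvalue:
  assumes Y: "Y \<in> carrier_mat N l" and D: "D \<in> carrier_mat l l" and h: "hermitian D"
    and psd: "\<And>c. c \<in> carrier_vec l \<Longrightarrow> 0 \<le> qform D c"
    and l: "0 < l" and N: "0 < N" and x: "x \<in> carrier_vec N"
  shows "\<exists>\<tau>. eigenvalue (mat_adjoint Y * Y * D) \<tau> \<and>
    qform D (mat_adjoint Y *\<^sub>v x) \<le> Re \<tau> * (cvec_norm x)\<^sup>2"
proof -
  define K where "K = Y * D * mat_adjoint Y"
  have Y': "mat_adjoint Y \<in> carrier_mat l N" by (rule mat_adjoint_carrier[OF Y])
  have K: "K \<in> carrier_mat N N" unfolding K_def using Y D Y' by (intro mult_carrier_mat)
  have T: "mat_adjoint Y * Y * D \<in> carrier_mat l l" using Y Y' D by (intro mult_carrier_mat)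
  have hK: "hermitian K"
    using h mat_adjoint_mult[OF Y D] mat_adjoint_mult[of "Y * D" N l "mat_adjoint Y" N] Y Y' D
      assoc_mult_mat[OF Y D Y'] unfolding hermitian_def K_def by simp
  have Tv: "(mat_adjoint Y * Y * D) *\<^sub>v v = mat_adjoint Y *\<^sub>v (Y *\<^sub>v (D *\<^sub>v v))"
    if "v \<in> carrier_vec l" for v
    using assoc_mult_mat_vec[OF mult_carrier_mat[OF Y' Y] D that]
      assoc_mult_mat_vec[OF Y' Y mult_mat_vec_carrier[OF D that]] by simp
  from hermitian_top_eigenvalue[OF K hK N] obtain \<kappa> where \<kappa>: "eigenvalue K (complex_of_real \<kappa>)"
    and le: "\<And>x. x \<in> carrier_vec N \<Longrightarrow> qform K x \<le> \<kappa> * (cvec_norm x)\<^sup>2" by blast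
  have le: "qform D (mat_adjoint Y *\<^sub>v x) \<le> \<kappa> * (cvec_norm x)\<^sup>2"
    using le[OF x] qform_congruence[OF Y D x] unfolding K_def by simp
  show ?thesis
  proof (cases "\<kappa> > 0")
    case True
    from \<kappa> obtain z where z: "z \<in> carrier_vec N" "z \<noteq> 0\<^sub>v N" "K *\<^sub>v z = complex_of_real \<kappa> \<cdot>\<^sub>v z"
      unfolding eigenvalue_carrier_iff[OF K] by auto
    define v where "v = mat_adjoint Y *\<^sub>v z"
    have v: "v \<in> carrier_vec l" unfolding v_def using Y' z by simp
    have Kz: "Y *\<^sub>v (D *\<^sub>v v) = complex_of_real \<kappa> \<cdot>\<^sub>v z"
      unfolding z(3)[symmetric] K_def v_def using congruence_mult_vec[OF Y D z(1)] by simp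
    have "v \<noteq> 0\<^sub>v l"
    proof
      assume "v = 0\<^sub>v l"
      then have "complex_of_real \<kappa> \<cdot>\<^sub>v z = 0\<^sub>v N" unfolding Kz[symmetric] using mult_mat_zero_vec[OF D] mult_mat_zero_vec[OF Y] by simp
      then have "z = 0\<^sub>v N" using True z by (auto simp: vec_eq_iff)
      then show False using z by simp
    qed
    moreover have "(mat_adjoint Y * Y * D) *\<^sub>v v = complex_of_real \<kappa> \<cdot>\<^sub>v v"
      unfolding Tv[OF v] Kz using mult_mat_vec[OF Y' z(1)] v_def by simp
    ultimately have "eigenvalue (mat_adjoint Y * Y * D) (complex_of_real \<kappa>)"
      unfolding eigenvalue_carrier_iff[OF T] using v by auto
    then show ?thesis using le by (intro exI[of _ "complex_of_real \<kappa>"]) simp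
  next
    case False
    from spectrum_non_empty[OF T] l obtain \<tau> where \<tau>: "eigenvalue (mat_adjoint Y * Y * D) \<tau>"
      unfolding spectrum_def by auto
    then obtain v where v: "v \<in> carrier_vec l" "v \<noteq> 0\<^sub>v l" "mat_adjoint Y *\<^sub>v (Y *\<^sub>v (D *\<^sub>v v)) = \<tau> \<cdot>\<^sub>v v"
      unfolding eigenvalue_carrier_iff[OF T] using Tv by auto
    have Dv: "D *\<^sub>v v \<in> carrier_vec l" and YDv: "Y *\<^sub>v (D *\<^sub>v v) \<in> carrier_vec N"
      using D Y v by auto
    \<comment> \<open>Pairing \<open>Y\<^sup>* Y D v = \<tau> v\<close> with \<open>D v\<close> gives \<open>\<parallel>Y D v\<parallel>\<^sup>2 = \<tau> qform D v\<close>.\<close>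
    have "Re \<tau> \<ge> 0"
    proof (cases "qform D v = 0")
      case True
      then have "D *\<^sub>v v = 0\<^sub>v l" using psd_qform_zero[OF D h psd v(1)] by simp
      then have "\<tau> \<cdot>\<^sub>v v = 0\<^sub>v l" using v(3) mult_mat_zero_vec[OF Y] mult_mat_zero_vec[OF Y'] by simp
      then have "\<tau> = 0" using v by (auto simp: vec_eq_iff)
      then show ?thesis by simp
    next
      case False
      have "complex_of_real ((cvec_norm (Y *\<^sub>v (D *\<^sub>v v)))\<^sup>2) = (\<tau> \<cdot>\<^sub>v v) \<bullet>c (D *\<^sub>v v)"
        unfolding v(3)[symmetric] cscalar_prod_self[symmetric]
        using cscalar_prod_adjoint[OF Y' YDv Dv] by simp
      also have "\<dots> = \<tau> * (v \<bullet>c (D *\<^sub>v v))" using v Dv by (intro cscalar_prod_smult_left)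
      also have "v \<bullet>c (D *\<^sub>v v) = complex_of_real (qform D v)"
        using hermitian_cscalar_prod[OF D h v(1) v(1)] cscalar_prod_commute[OF v(1) Dv]
        unfolding qform_def by (simp add: complex_eq_iff)
      finally have "(cvec_norm (Y *\<^sub>v (D *\<^sub>v v)))\<^sup>2 = Re \<tau> * qform D v"
        by (simp add: complex_eq_iff)
      then show ?thesis using psd[OF v(1)] False
        by (metis less_eq_real_def mult_neg_pos not_le zero_le_power2)
    qed
    then have "qform D (mat_adjoint Y *\<^sub>v x) \<le> Re \<tau> * (cvec_norm x)\<^sup>2"
      using le False by (smt (verit) mult_nonneg_nonneg mult_nonpos_nonneg zero_le_power2)
    then show ?thesis using \<tau> by blast
  qed
qed


section \<open>The correction beta\<close>

lemma kth_eigval_shift_minus_gram_product: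
  assumes Y: "Y \<in> carrier_mat N l" and D: "D \<in> carrier_mat l l" and h: "hermitian D"
    and psd: "\<And>c. c \<in> carrier_vec l \<Longrightarrow> 0 \<le> qform D c"
    and l: "0 < l" and N: "0 < N" and x: "x \<in> carrier_vec N" and 1: "cvec_norm x = 1"
  shows "kth_eigval (complex_of_real c \<cdot>\<^sub>m 1\<^sub>m l - mat_adjoint Y * Y * D) 1
    \<le> c - qform D (mat_adjoint Y *\<^sub>v x)" (is "kth_eigval ?T 1 \<le> _")
proof -
  let ?G = "mat_adjoint Y * Y * D"
  have G: "?G \<in> carrier_mat l l"
    by (rule mult_carrier_mat[OF mult_carrier_mat[OF mat_adjoint_carrier[OF Y] Y] D])
  have T: "?T \<in> carrier_mat l l" using G by (intro minus_carrier_mat)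
  obtain \<tau> where "eigenvalue ?G \<tau>" and le: "qform D (mat_adjoint Y *\<^sub>v x) \<le> Re \<tau>"
    using gram_product_eigenvalue[OF Y D h psd l N x] 1 by auto
  then obtain v where v: "v \<in> carrier_vec l" "v \<noteq> 0\<^sub>v l" "?G *\<^sub>v v = \<tau> \<cdot>\<^sub>v v"
    unfolding eigenvalue_carrier_iff[OF G] by auto
  have "?T *\<^sub>v v = complex_of_real c \<cdot>\<^sub>v v - \<tau> \<cdot>\<^sub>v v"
    using G v by (subst minus_mult_distrib_mat_vec[of _ l l]) (auto simp: smult_mat_mult_vec[of _ l l])
  also have "\<dots> = (complex_of_real c - \<tau>) \<cdot>\<^sub>v v"
    using v by (intro eq_vecI) (auto simp: algebra_simps)
  finally have "eigenvalue ?T (complex_of_real c - \<tau>)"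
    unfolding eigenvalue_carrier_iff[OF T] using v by auto
  from eigenvalue_bounds(1)[OF T this] le show ?thesis by simp
qed

lemma real_diag_hermitian: "hermitian (mat_diag l (\<lambda>i. complex_of_real (d i)))"
  unfolding hermitian_def by (rule eq_matI) (auto simp: mat_diag_def)

lemma qform_real_diag:
  assumes "c \<in> carrier_vec l"
  shows "qform (mat_diag l (\<lambda>i. complex_of_real (d i))) c = (\<Sum>i<l. d i * (cmod (vec_index c i))\<^sup>2)"
proof -
  have "(mat_diag l (\<lambda>i. complex_of_real (d i)) *\<^sub>v c) \<bullet>c c
    = (\<Sum>i<l. complex_of_real (d i) * (vec_index c i * cnj (vec_index c i)))"
    unfolding cscalar_prod_sum[OF assms]
    by (intro sum.cong refl, subst index_mult_mat_vec_sum[of _ l l])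
       (use assms in \<open>auto simp: mat_diag_def if_distrib[of "\<lambda>z. z * _"] cong: if_cong\<close>)
  also have "\<dots> = complex_of_real (\<Sum>i<l. d i * (cmod (vec_index c i))\<^sup>2)"
    unfolding of_real_sum of_real_mult complex_norm_square by (rule refl)
  finally show ?thesis unfolding qform_def by simp
qed

text \<open>\<open>Y\<close> is the orthogonal projection of the frame \<open>W\<close> onto the complement of the range of \<open>U\<close>. Replacing
  \<open>W\<close> by \<open>Y\<close> does not change the coefficients of a vector \<open>x\<close> of that complement, and the Gram matrix of \<open>Y\<close>
  is what enters \<^const>\<open>beta\<close>.\<close>

lemma gram_of_projected_frame:
  fixes U W :: "complex mat"
  assumes U: "U \<in> carrier_mat N s" and UU: "mat_adjoint U * U = 1\<^sub>m s"
    and W: "W \<in> carrier_mat N l" and WW: "mat_adjoint W * W = 1\<^sub>m l"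
    and x: "x \<in> carrier_vec N" and perp: "mat_adjoint U *\<^sub>v x = 0\<^sub>v s"
  defines "Y \<equiv> W - U * (mat_adjoint U * W)"
  shows "mat_adjoint Y * Y = 1\<^sub>m l - mat_adjoint W * U * mat_adjoint U * W"
    and "mat_adjoint Y *\<^sub>v x = mat_adjoint W *\<^sub>v x"
proof -
  define C where "C = mat_adjoint U * W"
  have U': "mat_adjoint U \<in> carrier_mat s N" and W': "mat_adjoint W \<in> carrier_mat l N"
    using U W by auto
  have C: "C \<in> carrier_mat s l" unfolding C_def using U' W by simp
  have C': "mat_adjoint C \<in> carrier_mat l s" using C by simp
  have Cadj: "mat_adjoint C = mat_adjoint W * U"
    unfolding C_def using mat_adjoint_mult[OF U' W] by simp
  have UC: "U * C \<in> carrier_mat N l" using U C by simp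
  have YC: "Y = W - U * C" unfolding Y_def C_def ..
  have Y: "Y \<in> carrier_mat N l" unfolding YC using UC by (intro minus_carrier_mat)
  have Y': "mat_adjoint Y = mat_adjoint W - mat_adjoint C * mat_adjoint U"
    unfolding YC mat_adjoint_minus[OF W UC] mat_adjoint_mult[OF U C] by (rule refl)
  have CU: "mat_adjoint C * mat_adjoint U \<in> carrier_mat l N" using C' U' by simp
  have UY: "mat_adjoint U * Y = 0\<^sub>m s l"
  proof -
    have "mat_adjoint U * Y = mat_adjoint U * W - mat_adjoint U * (U * C)"
      unfolding YC by (rule mult_minus_distrib_mat[OF U' W UC])
    also have "mat_adjoint U * (U * C) = C"
      using assoc_mult_mat[OF U' U C] C unfolding UU by simp
    finally show ?thesis using C unfolding C_def by auto
  qed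
  have "mat_adjoint Y * Y = mat_adjoint W * Y - mat_adjoint C * mat_adjoint U * Y"
    unfolding Y' by (rule minus_mult_distrib_mat[OF W' CU Y])
  also have "mat_adjoint C * mat_adjoint U * Y = 0\<^sub>m l l"
    unfolding assoc_mult_mat[OF C' U' Y] UY by (rule right_mult_zero_mat[OF C'])
  also have "mat_adjoint W * Y = mat_adjoint W * W - mat_adjoint W * (U * C)"
    unfolding YC by (rule mult_minus_distrib_mat[OF W' W UC])
  also have "mat_adjoint W * (U * C) = mat_adjoint W * U * mat_adjoint U * W"
    unfolding C_def assoc_mult_mat[OF W' U mult_carrier_mat[OF U' W], symmetric]
      assoc_mult_mat[OF mult_carrier_mat[OF W' U] U' W] by (rule refl)
  finally show "mat_adjoint Y * Y = 1\<^sub>m l - mat_adjoint W * U * mat_adjoint U * W"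
    unfolding WW using W by auto
  have "mat_adjoint Y *\<^sub>v x = mat_adjoint W *\<^sub>v x - mat_adjoint C * mat_adjoint U *\<^sub>v x"
    unfolding Y' by (rule minus_mult_distrib_mat_vec[OF W' CU x])
  also have "mat_adjoint C * mat_adjoint U *\<^sub>v x = 0\<^sub>v l"
    using assoc_mult_mat_vec[OF C' U' x] mult_mat_zero_vec[OF C'] unfolding perp by simp
  finally show "mat_adjoint Y *\<^sub>v x = mat_adjoint W *\<^sub>v x" using W by auto
qed

text \<open>Let \<open>D = \<lambda>\<^bsub>l+1\<^esub> I - \<Lambda>\<close>, which is positive semidefinite. Bounding every eigenvalue from the
  \<open>(l+1)\<close>-st on below by \<open>\<lambda>\<^bsub>l+1\<^esub>\<close> gives \<open>qform M x \<ge> \<lambda>\<^bsub>l+1\<^esub> - qform D (W\<^sup>* x)\<close> for a unit vector \<open>x\<close>. The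
  matrix in the definition of \<^const>\<open>beta\<close> equals \<open>(\<lambda>\<^bsub>l+1\<^esub> - \<lambda>\<^bsub>1\<^esub>) I - (I - W\<^sup>* U U\<^sup>* W) D\<close>, and
  \<open>I - W\<^sup>* U U\<^sup>* W\<close> is the Gram matrix of the projection of \<open>W\<close> onto the complement of \<open>U\<close>. As \<open>x\<close> lies in
  that complement, some eigenvalue of the product dominates \<open>qform D (W\<^sup>* x)\<close>.\<close>

lemma beta_lower_bound:
  assumes M: "M \<in> carrier_mat N N" and h: "hermitian M" and w: "orthonormal_eigvecs N M w"
    and l: "1 \<le> l" "l < N"
    and U: "U \<in> carrier_mat N s" and UU: "mat_adjoint U * U = 1\<^sub>m s"
    and x: "x \<in> carrier_vec N" and perp: "mat_adjoint U *\<^sub>v x = 0\<^sub>v s" and 1: "cvec_norm x = 1"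
  shows "kth_eigval M 1 + beta N M w l U \<le> qform M x"
proof -
  define lam where "lam = kth_eigval M"
  define W where "W = mat_of_cols N (map w [1..<Suc l])"
  define D where "D = mat_diag l (\<lambda>i. complex_of_real (lam (l + 1) - lam (i + 1)))"
  define Y where "Y = W - U * (mat_adjoint U * W)"
  define B where "B = mat_adjoint W * U * mat_adjoint U * W"
  have wc: "w k \<in> carrier_vec N" if "k \<in> {1..N}" for k
    using w that unfolding orthonormal_eigvecs_def by auto
  have on: "w i \<bullet>c w j = (if i = j then 1 else 0)" if "i \<in> {1..N}" "j \<in> {1..N}" for i j
    using w that unfolding orthonormal_eigvecs_def by auto
  have W: "W \<in> carrier_mat N l" unfolding W_def by (rule mat_of_cols_map_carrier)
  have WW: "mat_adjoint W * W = 1\<^sub>m l"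
    unfolding W_def by (rule adjoint_mult_orthonormal_cols) (use wc on l in auto)
  have Y: "Y \<in> carrier_mat N l" unfolding Y_def using U W by (intro minus_carrier_mat) auto
  have D: "D \<in> carrier_mat l l" unfolding D_def by simp
  have hD: "hermitian D" unfolding D_def by (rule real_diag_hermitian)
  have B: "B \<in> carrier_mat l l"
    unfolding B_def using U W by (intro carrier_matI) auto
  have YY: "mat_adjoint Y * Y = 1\<^sub>m l - B" and Yx: "mat_adjoint Y *\<^sub>v x = mat_adjoint W *\<^sub>v x"
    using gram_of_projected_frame[OF U UU W WW x perp] unfolding Y_def B_def by auto
  have psd: "0 \<le> qform D c" if "c \<in> carrier_vec l" for c
    unfolding D_def qform_real_diag[OF that] lam_def
    using kth_eigval_mono[OF M] l by (intro sum_nonneg mult_nonneg_nonneg) auto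
  have \<Lambda>: "mat_diag l (\<lambda>i. complex_of_real (lam (i + 1))) - complex_of_real (lam (l + 1)) \<cdot>\<^sub>m 1\<^sub>m l = - D"
    by (rule eq_matI) (auto simp: D_def mat_diag_def)
  define E where "E = B * D"
  have E: "E \<in> carrier_mat l l" unfolding E_def by (rule mult_carrier_mat[OF B D])
  have BD: "B * (- D) = - E" unfolding E_def
    by (rule uminus_mult_right_mat) (use B D in auto)
  have GD: "(1\<^sub>m l - B) * D = D - E" unfolding E_def
    using minus_mult_distrib_mat[OF one_carrier_mat B D] D by simp
  have "(mat_diag l (\<lambda>i. complex_of_real (lam (i + 1))) - complex_of_real (lam 1) \<cdot>\<^sub>m 1\<^sub>m l) - B * (- D)
      = complex_of_real (lam (l + 1) - lam 1) \<cdot>\<^sub>m 1\<^sub>m l - mat_adjoint Y * Y * D"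
    unfolding YY BD GD by (rule eq_matI) (use E in \<open>auto simp: D_def mat_diag_def\<close>)
  then have beta: "beta N M w l U = kth_eigval (complex_of_real (lam (l + 1) - lam 1) \<cdot>\<^sub>m 1\<^sub>m l - mat_adjoint Y * Y * D) 1"
    unfolding beta_def Let_def W_def[symmetric] lam_def[symmetric] B_def[symmetric] \<Lambda> by simp
  have "beta N M w l U \<le> lam (l + 1) - lam 1 - qform D (mat_adjoint Y *\<^sub>v x)"
    unfolding beta by (rule kth_eigval_shift_minus_gram_product[OF Y D hD psd _ _ x 1])
      (use l in auto)
  moreover have "lam (l + 1) - qform D (mat_adjoint Y *\<^sub>v x) \<le> qform M x"
  proof -
    have c: "vec_index (mat_adjoint W *\<^sub>v x) i = x \<bullet>c w (Suc i)" if "i < l" for i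
      using index_adjoint_mult_vec[OF W x that] col_mat_of_cols_map[of l w N i] wc that l by (simp add: W_def)
    have "qform D (mat_adjoint Y *\<^sub>v x) = (\<Sum>i<l. (lam (l + 1) - lam (Suc i)) * (cmod (x \<bullet>c w (Suc i)))\<^sup>2)"
      unfolding Yx D_def by (subst qform_real_diag) (use W x c in \<open>auto intro!: mult_mat_vec_carrier[of _ l N]\<close>)
    also have "\<dots> = (\<Sum>i=1..l. (lam (l + 1) - lam i) * (cmod (x \<bullet>c w i))\<^sup>2)"
      using sum.shift_bounds_Suc_ivl[of "\<lambda>i. (lam (l + 1) - lam i) * (cmod (x \<bullet>c w i))\<^sup>2" 0 l]
      by (simp add: atLeast0LessThan atLeastLessThanSuc_atLeastAtMost)
    also have "\<dots> \<ge> (\<Sum>i=1..N. (lam (l + 1) - lam i) * (cmod (x \<bullet>c w i))\<^sup>2)"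
    proof -
      have "{1..N} = {1..l} \<union> {l+1..N}" using l by auto
      then have "(\<Sum>i=1..N. (lam (l + 1) - lam i) * (cmod (x \<bullet>c w i))\<^sup>2)
        = (\<Sum>i=1..l. (lam (l + 1) - lam i) * (cmod (x \<bullet>c w i))\<^sup>2)
          + (\<Sum>i=l+1..N. (lam (l + 1) - lam i) * (cmod (x \<bullet>c w i))\<^sup>2)"
        by (simp only:, intro sum.union_disjoint) auto
      moreover have "(\<Sum>i=l+1..N. (lam (l + 1) - lam i) * (cmod (x \<bullet>c w i))\<^sup>2) \<le> 0"
        unfolding lam_def using kth_eigval_mono[OF M] by (intro sum_nonpos mult_nonpos_nonneg) auto
      ultimately show ?thesis by linarith
    qed
    also have "(\<Sum>i=1..N. (lam (l + 1) - lam i) * (cmod (x \<bullet>c w i))\<^sup>2) = lam (l + 1) * (cvec_norm x)\<^sup>2 - qform M x"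
      unfolding eigvecs_expansion[OF M h w x] lam_def by (simp add: algebra_simps sum_subtractf sum_distrib_left)
    finally show ?thesis using 1 by simp
  qed
  ultimately show ?thesis unfolding lam_def by linarith
qed


section \<open>Spectral norm\<close>

text \<open>\<^const>\<open>spectral_norm\<close> is a conditionally complete supremum, so its bound requires the set to be
  bounded above; the top eigenvalue of \<open>M\<^sup>* M\<close> provides the bound.\<close>

lemma spectral_norm_mult_vec:
  assumes M: "M \<in> carrier_mat n m" and m: "0 < m" and v: "v \<in> carrier_vec m"
  shows "cvec_norm (M *\<^sub>v v) \<le> spectral_norm M * cvec_norm v"
proof -
  let ?H = "mat_adjoint M * M"
  have M': "mat_adjoint M \<in> carrier_mat m n" using M by simp
  have H: "?H \<in> carrier_mat m m" by (rule mult_carrier_mat[OF M' M])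
  have h: "hermitian ?H" unfolding hermitian_def using mat_adjoint_mult[OF M' M] by simp
  have q: "qform ?H x = (cvec_norm (M *\<^sub>v x))\<^sup>2" if x: "x \<in> carrier_vec m" for x
  proof -
    have "(?H *\<^sub>v x) \<bullet>c x = (M *\<^sub>v x) \<bullet>c (M *\<^sub>v x)"
      using assoc_mult_mat_vec[OF M' M x] cscalar_prod_adjoint[OF M' mult_mat_vec_carrier[OF M x] x] by simp
    then show ?thesis unfolding qform_def by (simp add: cscalar_prod_self)
  qed
  from hermitian_top_eigenvalue[OF H h m] obtain \<kappa> where
    \<kappa>: "\<And>x. x \<in> carrier_vec m \<Longrightarrow> qform ?H x \<le> \<kappa> * (cvec_norm x)\<^sup>2" by blast
  have bdd: "bdd_above ((\<lambda>v. cvec_norm (M *\<^sub>v v)) ` {v \<in> carrier_vec (dim_col M). cvec_norm v \<le> 1})"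
  proof (rule bdd_aboveI2)
    fix x assume "x \<in> {v \<in> carrier_vec (dim_col M). cvec_norm v \<le> 1}"
    then have x: "x \<in> carrier_vec m" "cvec_norm x \<le> 1" using M by auto
    have "(cvec_norm (M *\<^sub>v x))\<^sup>2 \<le> \<kappa> * (cvec_norm x)\<^sup>2" using \<kappa>[OF x(1)] q[OF x(1)] by simp
    also have "\<dots> \<le> \<bar>\<kappa>\<bar> * 1"
      using x(2) by (intro mult_mono) (auto simp: power_le_one)
    finally show "cvec_norm (M *\<^sub>v x) \<le> sqrt \<bar>\<kappa>\<bar>" by (simp add: real_le_rsqrt)
  qed
  show ?thesis
  proof (cases "cvec_norm v = 0")
    case True
    then show ?thesis using cvec_norm_eq_0[OF v True] mult_mat_zero_vec[OF M] by (simp add: cvec_norm_def)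
  next
    case False
    then obtain y where y: "y \<in> carrier_vec m" "cvec_norm y = 1" "v = complex_of_real (cvec_norm v) \<cdot>\<^sub>v y"
      using unit_vector_scaling[OF v] by blast
    have "M *\<^sub>v v = complex_of_real (cvec_norm v) \<cdot>\<^sub>v (M *\<^sub>v y)"
      using mult_mat_vec[OF M y(1)] y(3) by metis
    then have "cvec_norm (M *\<^sub>v v) = cvec_norm v * cvec_norm (M *\<^sub>v y)" by (simp add: cvec_norm_smult)
    moreover have "cvec_norm (M *\<^sub>v y) \<le> spectral_norm M"
      unfolding spectral_norm_def by (rule cSUP_upper[OF _ bdd]) (use y M in auto)
    ultimately show ?thesis by (simp add: mult.commute mult_left_mono)
  qed
qed


section \<open>A vector of low energy with prescribed orthogonality\<close>

lemma nontrivial_kernel_zero_row: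
  fixes B :: "complex mat"
  assumes B: "B \<in> carrier_mat k k" and i: "i < k" and zero: "\<And>j. j < k \<Longrightarrow> index_mat B (i, j) = 0"
  shows "\<exists>c\<in>carrier_vec k. c \<noteq> 0\<^sub>v k \<and> B *\<^sub>v c = 0\<^sub>v k"
proof -
  have BT: "transpose_mat B \<in> carrier_mat k k" using B by simp
  have "transpose_mat B *\<^sub>v unit_vec k i = 0\<^sub>v k"
    by (rule eq_vecI) (use B i zero in auto)
  then have "Determinant.det (transpose_mat B) = 0"
    unfolding det_0_iff_vec_prod_zero[OF BT] using i by (intro exI[of _ "unit_vec k i"]) auto
  then show ?thesis using det_transpose[OF B] det_0_iff_vec_prod_zero[OF B] by auto
qed

text \<open>The half of the Courant-Fischer theorem that is needed. On the span of \<open>w\<^bsub>1\<^esub>, ..., w\<^bsub>k\<^esub>\<close> the form is at most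
  \<open>\<lambda>\<^bsub>k\<^esub> \<parallel>x\<parallel>\<^sup>2\<close>, and \<open>k - 1\<close> linear conditions cannot exclude all nonzero vectors of this \<open>k\<close>-dimensional space.\<close>

lemma low_energy_vector:
  assumes M: "M \<in> carrier_mat N N" and h: "hermitian M" and w: "orthonormal_eigvecs N M w"
    and k: "1 \<le> k" "k \<le> N" and p: "\<And>i. i \<in> {1..<k} \<Longrightarrow> p i \<in> carrier_vec N"
  obtains x where "x \<in> carrier_vec N" "cvec_norm x \<noteq> 0" "\<And>i. i \<in> {1..<k} \<Longrightarrow> x \<bullet>c p i = 0"
    "qform M x \<le> kth_eigval M k * (cvec_norm x)\<^sup>2"
proof -
  have wc: "w i \<in> carrier_vec N" if "i \<in> {1..N}" for i
    using w that unfolding orthonormal_eigvecs_def by auto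
  have on: "w i \<bullet>c w j = (if i = j then 1 else 0)" if "i \<in> {1..N}" "j \<in> {1..N}" for i j
    using w that unfolding orthonormal_eigvecs_def by auto
  define W where "W = mat_of_cols N (map w [1..<Suc k])"
  have W: "W \<in> carrier_mat N k" unfolding W_def by (rule mat_of_cols_map_carrier)
  have W': "mat_adjoint W \<in> carrier_mat k N" using W by simp
  have WW: "mat_adjoint W * W = 1\<^sub>m k"
    unfolding W_def by (rule adjoint_mult_orthonormal_cols) (use wc on k in auto)
  have col: "Matrix.col W j = w (Suc j)" if "j < k" for j
    unfolding W_def by (rule col_mat_of_cols_map) (use wc k that in auto)
  have Wc: "(W *\<^sub>v c) \<bullet>c y = (\<Sum>j<k. vec_index c j * (w (Suc j) \<bullet>c y))"
    if c: "c \<in> carrier_vec k" and y: "y \<in> carrier_vec N" for c y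
  proof -
    have "cnj (vec_index (mat_adjoint W *\<^sub>v y) j) = w (Suc j) \<bullet>c y" if "j < k" for j
      using index_adjoint_mult_vec[OF W y that] col[OF that] cscalar_prod_commute[OF y, of "w (Suc j)"]
        wc[of "Suc j"] that k by simp
    then show ?thesis
      unfolding cscalar_prod_adjoint[OF W c y] cscalar_prod_sum[OF mult_mat_vec_carrier[OF W' y]] by simp
  qed
  \<comment> \<open>The orthogonality conditions on the coefficients, made square by a zero row.\<close>
  define B where "B = Matrix.mat k k (\<lambda>(i, j). if i = k - 1 then 0 else w (Suc j) \<bullet>c p (Suc i))"
  have B: "B \<in> carrier_mat k k" unfolding B_def by simp
  obtain c where c: "c \<in> carrier_vec k" "c \<noteq> 0\<^sub>v k" "B *\<^sub>v c = 0\<^sub>v k"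
    using nontrivial_kernel_zero_row[OF B, of "k - 1"] k by (auto simp: B_def)
  let ?x = "W *\<^sub>v c"
  have x: "?x \<in> carrier_vec N" using W c by simp
  have "?x \<bullet>c ?x = c \<bullet>c c"
    using cscalar_prod_adjoint[OF W c(1) x] assoc_mult_mat_vec[OF W' W c(1)] c unfolding WW by simp
  then have norm: "(cvec_norm ?x)\<^sup>2 = (cvec_norm c)\<^sup>2" by (simp only: cscalar_prod_self of_real_eq_iff)
  have "x' \<bullet>c p i = 0" if "i \<in> {1..<k}" "x' = ?x" for i x'
  proof -
    have i: "i - 1 < k" "i - 1 \<noteq> k - 1" "Suc (i - 1) = i" using that by auto
    have "vec_index (B *\<^sub>v c) (i - 1) = 0" using c(3) i by simp
    then have "(\<Sum>j<k. (w (Suc j) \<bullet>c p i) * vec_index c j) = 0"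
      unfolding index_mult_mat_vec_sum[OF B c(1) i(1)] using i by (simp add: B_def)
    then show ?thesis unfolding that(2) Wc[OF c(1) p[OF that(1)]] by (simp add: mult.commute)
  qed
  moreover have "cvec_norm ?x \<noteq> 0" using norm c cvec_norm_eq_0[OF c(1)] by auto
  moreover have "qform M ?x \<le> kth_eigval M k * (cvec_norm ?x)\<^sup>2"
    unfolding eigvecs_expansion[OF M h w x] sum_distrib_left
  proof (rule sum_mono)
    fix i assume i: "i \<in> {1..N}"
    show "kth_eigval M i * (cmod (?x \<bullet>c w i))\<^sup>2 \<le> kth_eigval M k * (cmod (?x \<bullet>c w i))\<^sup>2"
    proof (cases "i \<le> k")
      case True
      then show ?thesis using kth_eigval_mono[OF M, of i k] i k by (intro mult_right_mono) auto
    next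
      case False
      then have "?x \<bullet>c w i = 0" unfolding Wc[OF c(1) wc[OF i]]
        using on i k by (intro sum.neutral) auto
      then show ?thesis by simp
    qed
  qed
  ultimately show thesis using that x by blast
qed


section \<open>Eigenvalue bound from a two-block splitting\<close>

text \<open>The subtracted term \<open>\<delta>\<close> is the nonnegative root of \<open>\<delta> (\<delta> + g) = r\<^sup>2\<close>. With \<open>g = \<bar>q - p\<bar>\<close> the left
  factor is the smaller eigenvalue of the matrix with diagonal \<open>p, q\<close> and off-diagonal entries \<open>- r\<close>;
  a smaller \<open>g\<close> only increases \<open>\<delta>\<close>. Subtracting \<open>min p q - \<delta>\<close> from the diagonal leaves \<open>\<delta>\<close> and \<open>\<delta> + \<bar>q - p\<bar>\<close>,
  whose product is at least \<open>r\<^sup>2\<close>, hence a positive semidefinite matrix.\<close>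

lemma two_by_two_lower_bound:
  fixes a b r g p q :: real
  assumes "0 \<le> a" "0 \<le> b" "0 \<le> r" "0 \<le> g" "g \<le> \<bar>q - p\<bar>"
  shows "(min p q - 2 * r\<^sup>2 / (g + sqrt (g\<^sup>2 + 4 * r\<^sup>2))) * (a\<^sup>2 + b\<^sup>2) \<le> p * a\<^sup>2 - 2 * r * a * b + q * b\<^sup>2"
proof -
  define t where "t = sqrt (g\<^sup>2 + 4 * r\<^sup>2)"
  define \<delta> where "\<delta> = 2 * r\<^sup>2 / (g + t)"
  define d where "d = \<bar>q - p\<bar>"
  have t: "0 \<le> t" "t\<^sup>2 = g\<^sup>2 + 4 * r\<^sup>2" unfolding t_def by auto
  have \<delta>: "0 \<le> \<delta>" unfolding \<delta>_def using t assms by (intro divide_nonneg_nonneg) auto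
  have "\<delta> * (\<delta> + g) = r\<^sup>2"
  proof (cases "g + t = 0")
    case True
    then have "g = 0" "t = 0" using t assms by linarith+
    then show ?thesis using t by (simp add: \<delta>_def)
  next
    case False
    have "(2 * r\<^sup>2) * 2 = (t - g) * (g + t)" using t by (simp add: power2_eq_square algebra_simps)
    then have "\<delta> = (t - g) / 2" unfolding \<delta>_def using False by (simp add: field_simps)
    then have "t = g + 2 * \<delta>" by simp
    then have "(g + 2 * \<delta>)\<^sup>2 = g\<^sup>2 + 4 * r\<^sup>2" using t(2) by simp
    then show ?thesis by (simp add: power2_eq_square algebra_simps)
  qed
  then have rd: "r\<^sup>2 \<le> \<delta> * (\<delta> + d)"
    using \<delta> assms unfolding d_def by (smt (verit) mult_left_mono)
  have key: "0 \<le> \<delta> * u\<^sup>2 - 2 * r * u * v + (\<delta> + d) * v\<^sup>2" if "0 \<le> u" "0 \<le> v" for u v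
  proof -
    have d: "0 \<le> \<delta> + d" using \<delta> unfolding d_def by simp
    have "r \<le> sqrt \<delta> * sqrt (\<delta> + d)"
      using real_le_rsqrt[OF rd] by (simp add: real_sqrt_mult)
    then have "2 * (u * v) * r \<le> 2 * (u * v) * (sqrt \<delta> * sqrt (\<delta> + d))"
      using that by (intro mult_left_mono) auto
    moreover have "0 \<le> (sqrt \<delta> * u - sqrt (\<delta> + d) * v)\<^sup>2" by simp
    then have "0 \<le> \<delta> * u\<^sup>2 - 2 * (u * v) * (sqrt \<delta> * sqrt (\<delta> + d)) + (\<delta> + d) * v\<^sup>2"
      using \<delta> d by (simp add: power2_diff power_mult_distrib algebra_simps)
    ultimately show ?thesis by (simp add: algebra_simps)
  qed
  have "(min p q - \<delta>) * (a\<^sup>2 + b\<^sup>2) \<le> p * a\<^sup>2 - 2 * r * a * b + q * b\<^sup>2"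
  proof (cases "p \<le> q")
    case True
    then have "q = p + d" by (simp add: d_def)
    then show ?thesis using key[of a b] assms True by (simp add: algebra_simps)
  next
    case False
    then have "p = q + d" by (simp add: d_def)
    then show ?thesis using key[of b a] assms False by (simp add: algebra_simps)
  qed
  then show ?thesis unfolding \<delta>_def t_def .
qed

text \<open>The case distinction disappears because a quotient with denominator zero is zero.\<close>

lemma lambda_SLB_eq:
  "lambda_SLB lamV \<eta> \<rho> k = min (lamV k) \<eta> - 2 * \<rho>\<^sup>2 / (gap lamV k \<eta> + sqrt ((gap lamV k \<eta>)\<^sup>2 + 4 * \<rho>\<^sup>2))"
  unfolding lambda_SLB_def by simp

text \<open>Choose \<open>x \<noteq> 0\<close> with \<open>qform M x \<le> \<lambda>\<^bsub>k\<^esub>(M) \<parallel>x\<parallel>\<^sup>2\<close> that is orthogonal to the first \<open>k - 1\<close> columns of \<open>U\<close>, and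
  write \<open>x = U a + z\<close> with \<open>z\<close> orthogonal to the range of \<open>U\<close>. The first \<open>k - 1\<close> entries of \<open>a\<close> vanish, so the block
  of \<open>U\<close> contributes at least \<open>lam k \<parallel>a\<parallel>\<^sup>2\<close>, the complement contributes at least \<open>\<eta> \<parallel>z\<parallel>\<^sup>2\<close>, and the cross terms cost at most
  \<open>2 \<rho> \<parallel>a\<parallel> \<parallel>z\<parallel>\<close>. What remains is the two-by-two problem for \<open>(\<parallel>a\<parallel>, \<parallel>z\<parallel>)\<close>.\<close>

lemma two_block_eigenvalue_bound:
  assumes M: "M \<in> carrier_mat N N" and h: "hermitian M" and w: "orthonormal_eigvecs N M w"
    and U: "U \<in> carrier_mat N s" and UU: "mat_adjoint U * U = 1\<^sub>m s"
    and diag: "mat_adjoint U * M * U = mat_diag s (\<lambda>i. complex_of_real (lam (Suc i)))"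
    and mono: "\<And>i j. 1 \<le> i \<Longrightarrow> i \<le> j \<Longrightarrow> j \<le> s \<Longrightarrow> lam i \<le> lam j"
    and \<eta>: "\<And>z. z \<in> carrier_vec N \<Longrightarrow> mat_adjoint U *\<^sub>v z = 0\<^sub>v s \<Longrightarrow> \<eta> * (cvec_norm z)\<^sup>2 \<le> qform M z"
    and \<rho>: "\<And>a z. a \<in> carrier_vec s \<Longrightarrow> z \<in> carrier_vec N \<Longrightarrow> mat_adjoint U *\<^sub>v z = 0\<^sub>v s \<Longrightarrow>
      cmod ((M *\<^sub>v (U *\<^sub>v a)) \<bullet>c z) \<le> \<rho> * (cvec_norm a * cvec_norm z)"
    and \<rho>0: "0 \<le> \<rho>"
    and k: "1 \<le> k" "k \<le> s" "k \<le> N"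
  shows "lambda_SLB lam \<eta> \<rho> k \<le> kth_eigval M k"
proof -
  have U': "mat_adjoint U \<in> carrier_mat s N" using U by simp
  have "Matrix.col U (i - 1) \<in> carrier_vec N" if "i \<in> {1..<k}" for i
    using U by auto
  then obtain x where x: "x \<in> carrier_vec N" "cvec_norm x \<noteq> 0"
    and orth: "\<And>i. i \<in> {1..<k} \<Longrightarrow> x \<bullet>c Matrix.col U (i - 1) = 0"
    and low: "qform M x \<le> kth_eigval M k * (cvec_norm x)\<^sup>2"
    using low_energy_vector[OF M h w k(1,3), of "\<lambda>i. Matrix.col U (i - 1)"] by blast
  define a where "a = mat_adjoint U *\<^sub>v x"
  define y where "y = U *\<^sub>v a"
  define z where "z = x - y"
  have a: "a \<in> carrier_vec s" unfolding a_def using U' x by simp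
  have y: "y \<in> carrier_vec N" unfolding y_def using U a by simp
  have z: "z \<in> carrier_vec N" unfolding z_def using x y by simp
  have xyz: "x = y + z" unfolding z_def using x y by auto
  have Uy: "mat_adjoint U *\<^sub>v y = a"
    unfolding y_def using assoc_mult_mat_vec[OF U' U a] a unfolding UU by simp
  have Uz: "mat_adjoint U *\<^sub>v z = 0\<^sub>v s"
    unfolding z_def mult_minus_distrib_mat_vec[OF U' x(1) y] Uy a_def[symmetric] using a by simp
  have a0: "vec_index a i = 0" if "i < k - 1" for i
    using index_adjoint_mult_vec[OF U x(1), of i] orth[of "Suc i"] that k unfolding a_def by simp
  have ny: "(cvec_norm y)\<^sup>2 = (cvec_norm a)\<^sup>2"
  proof -
    have "y \<bullet>c y = a \<bullet>c a" using cscalar_prod_adjoint[OF U a y] Uy unfolding y_def by simp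
    then show ?thesis by (simp only: cscalar_prod_self of_real_eq_iff)
  qed
  have yz: "y \<bullet>c z = 0"
    using cscalar_prod_adjoint[OF U a z] a unfolding Uz y_def by simp
  have nx: "(cvec_norm x)\<^sup>2 = (cvec_norm a)\<^sup>2 + (cvec_norm z)\<^sup>2"
  proof -
    have zy: "z \<bullet>c y = 0" using cscalar_prod_commute[OF y z] yz by simp
    have "x \<bullet>c x = y \<bullet>c y + z \<bullet>c z"
      unfolding xyz using y z yz zy by (simp add: cscalar_prod_add_left[of _ N] cscalar_prod_add_right[of _ N])
    then have "complex_of_real ((cvec_norm x)\<^sup>2) = complex_of_real ((cvec_norm y)\<^sup>2 + (cvec_norm z)\<^sup>2)"
      by (simp only: cscalar_prod_self of_real_add)
    then show ?thesis unfolding ny by (simp only: of_real_eq_iff)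
  qed
  have "lam k * (cvec_norm a)\<^sup>2 \<le> qform M y"
  proof -
    have "qform M y = qform (mat_adjoint U * M * U) a"
      using qform_congruence[OF U' M a] unfolding y_def by simp
    also have "\<dots> = (\<Sum>i<s. lam (Suc i) * (cmod (vec_index a i))\<^sup>2)"
      unfolding diag by (rule qform_real_diag[OF a])
    also have "\<dots> \<ge> (\<Sum>i<s. lam k * (cmod (vec_index a i))\<^sup>2)"
    proof (rule sum_mono)
      fix i assume i: "i \<in> {..<s}"
      show "lam k * (cmod (vec_index a i))\<^sup>2 \<le> lam (Suc i) * (cmod (vec_index a i))\<^sup>2"
      proof (cases "i < k - 1")
        case True
        then show ?thesis using a0 by simp
      next
        case False
        then show ?thesis using mono[of k "Suc i"] i k by (intro mult_right_mono) auto
      qed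
    qed
    also have "(\<Sum>i<s. lam k * (cmod (vec_index a i))\<^sup>2) = lam k * (cvec_norm a)\<^sup>2"
      unfolding cvec_norm_sq using a by (simp add: sum_distrib_left)
    finally show ?thesis .
  qed
  moreover have "- (\<rho> * (cvec_norm a * cvec_norm z)) \<le> Re ((M *\<^sub>v y) \<bullet>c z)"
    using \<rho>[OF a z Uz] abs_Re_le_cmod[of "(M *\<^sub>v y) \<bullet>c z"] unfolding y_def by linarith
  moreover have "\<eta> * (cvec_norm z)\<^sup>2 \<le> qform M z" by (rule \<eta>[OF z Uz])
  ultimately have "lam k * (cvec_norm a)\<^sup>2 - 2 * \<rho> * cvec_norm a * cvec_norm z + \<eta> * (cvec_norm z)\<^sup>2 \<le> qform M x"
    unfolding xyz qform_add[OF M h y z] by (simp add: algebra_simps)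
  moreover have "gap lam k \<eta> \<le> \<bar>\<eta> - lam k\<bar>" "0 \<le> gap lam k \<eta>"
    unfolding gap_def using k by (auto intro!: Min_le Min.boundedI)
  then have "lambda_SLB lam \<eta> \<rho> k * ((cvec_norm a)\<^sup>2 + (cvec_norm z)\<^sup>2)
      \<le> lam k * (cvec_norm a)\<^sup>2 - 2 * \<rho> * cvec_norm a * cvec_norm z + \<eta> * (cvec_norm z)\<^sup>2"
    unfolding lambda_SLB_eq using \<rho>0 by (intro two_by_two_lower_bound) auto
  ultimately have "lambda_SLB lam \<eta> \<rho> k * (cvec_norm x)\<^sup>2 \<le> kth_eigval M k * (cvec_norm x)\<^sup>2"
    using low unfolding nx by linarith
  then show ?thesis using x(2) by (simp add: mult_le_cancel_right)
qed


section \<open>Orthonormal basis matrices\<close>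

lemma is_onb_matrixD:
  assumes "is_onb_matrix N B S"
  shows "B \<in> carrier_mat N (dim_col B)" "mat_adjoint B * B = 1\<^sub>m (dim_col B)"
    "cspan N (set (cols B)) = S"
  using assms unfolding is_onb_matrix_def by auto

lemma cspan_cols:
  assumes "B \<in> carrier_mat N m"
  shows "cspan N (set (cols B)) = {B *\<^sub>v c | c. c \<in> carrier_vec m}"
proof -
  interpret vec_space "TYPE(complex)" N .
  have "cspan N (set (cols B)) = col_space B"
    unfolding cspan_def col_space_def by simp
  also have "\<dots> = {B *\<^sub>v c | c. c \<in> carrier_vec m}"
    unfolding col_space_eq[OF assms] using assms by auto
  finally show ?thesis .
qed

lemma cdim_eq_dim_col:
  assumes B: "is_onb_matrix N B S"
  shows "cdim N S = dim_col B"
proof -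
  interpret vec_space "TYPE(complex)" N .
  note onb = is_onb_matrixD[OF B]
  have gram: "Matrix.col B j \<bullet>c Matrix.col B i = (if i = j then 1 else 0)"
    if "i < dim_col B" "j < dim_col B" for i j
    using index_adjoint_mult_mat[OF onb(1) onb(1) that] that unfolding onb(2) by simp
  have dist: "distinct (cols B)"
    unfolding distinct_conv_nth
  proof (intro allI impI)
    fix i j assume ij: "i < length (cols B)" "j < length (cols B)" "i \<noteq> j"
    then show "cols B ! i \<noteq> cols B ! j"
      using gram[of i i] gram[of i j] by auto
  qed
  have "lin_indpt (set (cols B))"
  proof
    assume "lin_dep (set (cols B))"
    then obtain v where v: "v \<in> carrier_vec (dim_col B)" "v \<noteq> 0\<^sub>v (dim_col B)" "B *\<^sub>v v = 0\<^sub>v N"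
      using lin_depE[OF onb(1) _ dist] by blast
    have "v = mat_adjoint B *\<^sub>v (B *\<^sub>v v)"
      using assoc_mult_mat_vec[OF mat_adjoint_carrier[OF onb(1)] onb(1) v(1)] v(1) unfolding onb(2) by simp
    then show False using v mult_mat_zero_vec[OF mat_adjoint_carrier[OF onb(1)]] by simp
  qed
  then have "rank B = dim_col B" using lin_indpt_full_rank[OF onb(1) dist] by simp
  then show ?thesis unfolding rank_def cdim_def onb(3)[symmetric] cspan_def by simp
qed

lemma orth_complement_cspan_cols:
  assumes U: "U \<in> carrier_mat N s" and z: "z \<in> carrier_vec N" and perp: "mat_adjoint U *\<^sub>v z = 0\<^sub>v s"
  shows "z \<in> orth_complement N (cspan N (set (cols U)))"
proof -
  have "z \<bullet>c (U *\<^sub>v c) = 0" if c: "c \<in> carrier_vec s" for c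
  proof -
    have "(U *\<^sub>v c) \<bullet>c z = 0" using cscalar_prod_adjoint[OF U c z] c unfolding perp by simp
    then show ?thesis using cscalar_prod_commute[OF mult_mat_vec_carrier[OF U c] z] by simp
  qed
  then show ?thesis unfolding orth_complement_def cspan_cols[OF U] using z by auto
qed

text \<open>A vector \<open>z\<close> of the complement is \<open>Uperp b\<close> with \<open>\<parallel>b\<parallel> = \<parallel>z\<parallel>\<close>, which turns the coupling into a matrix element of
  \<open>Uperp\<^sup>* M U\<close>.\<close>

lemma residual_bound:
  assumes M: "M \<in> carrier_mat N N" and U: "U \<in> carrier_mat N s" and s: "0 < s"
    and onb: "is_onb_matrix N Uperp (orth_complement N (cspan N (set (cols U))))"
    and a: "a \<in> carrier_vec s" and z: "z \<in> carrier_vec N" and perp: "mat_adjoint U *\<^sub>v z = 0\<^sub>v s"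
  shows "cmod ((M *\<^sub>v (U *\<^sub>v a)) \<bullet>c z) \<le> residual M U Uperp * (cvec_norm a * cvec_norm z)"
proof -
  note X = is_onb_matrixD[OF onb]
  have X': "mat_adjoint Uperp \<in> carrier_mat (dim_col Uperp) N" by (rule mat_adjoint_carrier[OF X(1)])
  have R: "mat_adjoint Uperp * M * U \<in> carrier_mat (dim_col Uperp) s"
    by (rule mult_carrier_mat[OF mult_carrier_mat[OF X' M] U])
  obtain b where b: "b \<in> carrier_vec (dim_col Uperp)" "z = Uperp *\<^sub>v b"
    using orth_complement_cspan_cols[OF U z perp] unfolding X(3)[symmetric] cspan_cols[OF X(1)] by blast
  have "z \<bullet>c z = b \<bullet>c b"
    using cscalar_prod_adjoint[OF X(1) b(1) z] assoc_mult_mat_vec[OF X' X(1) b(1)] b unfolding X(2) by simp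
  then have "(cvec_norm z)\<^sup>2 = (cvec_norm b)\<^sup>2" by (simp only: cscalar_prod_self of_real_eq_iff)
  then have nz: "cvec_norm z = cvec_norm b" by (simp add: power2_eq_iff_nonneg)
  have Ua: "U *\<^sub>v a \<in> carrier_vec N" using U a by simp
  have MUa: "M *\<^sub>v (U *\<^sub>v a) \<in> carrier_vec N" using M Ua by simp
  have Ra: "mat_adjoint Uperp * M * U *\<^sub>v a = mat_adjoint Uperp *\<^sub>v (M *\<^sub>v (U *\<^sub>v a))"
    using assoc_mult_mat_vec[OF mult_carrier_mat[OF X' M] U a] assoc_mult_mat_vec[OF X' M Ua] by simp
  have "(M *\<^sub>v (U *\<^sub>v a)) \<bullet>c z = (mat_adjoint Uperp * M * U *\<^sub>v a) \<bullet>c b"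
    using cscalar_prod_adjoint[OF X' MUa b(1)] unfolding Ra b(2) by simp
  then have "cmod ((M *\<^sub>v (U *\<^sub>v a)) \<bullet>c z) \<le> cvec_norm (mat_adjoint Uperp * M * U *\<^sub>v a) * cvec_norm b"
    using cscalar_prod_Cauchy_Schwarz[OF mult_mat_vec_carrier[OF R a] b(1)] by simp
  also have "\<dots> \<le> (residual M U Uperp * cvec_norm a) * cvec_norm b"
    unfolding residual_def by (intro mult_right_mono spectral_norm_mult_vec[OF R s a] cvec_norm_nonneg)
  finally show ?thesis unfolding nz by (simp add: mult.assoc)
qed

lemma spectral_norm_nonneg:
  assumes M: "M \<in> carrier_mat n m" and m: "0 < m"
  shows "0 \<le> spectral_norm M"
proof -
  have "cvec_norm (unit_vec m 0 :: complex Matrix.vec) = 1"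
    using m by (simp add: cvec_norm_def unit_vec_def if_distrib[of cmod] if_distrib[of "\<lambda>t. t\<^sup>2"] cong: if_cong)
  then have "cvec_norm (M *\<^sub>v unit_vec m 0) \<le> spectral_norm M"
    using spectral_norm_mult_vec[OF M m, of "unit_vec m 0"] by simp
  then show ?thesis by (rule order_trans[OF cvec_norm_nonneg])
qed


section \<open>Ritz vectors and the linear program\<close>

lemma ritz_mat_properties:
  assumes V: "V \<in> carrier_mat N d" and VV: "mat_adjoint V * V = 1\<^sub>m d"
    and M: "M \<in> carrier_mat N N"
    and u: "orthonormal_eigvecs d (projected_mat V M) u" and s: "s \<le> d"
  shows "ritz_mat N V u s \<in> carrier_mat N s"
    and "mat_adjoint (ritz_mat N V u s) * ritz_mat N V u s = 1\<^sub>m s"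
    and "mat_adjoint (ritz_mat N V u s) * M * ritz_mat N V u s
      = mat_diag s (\<lambda>i. complex_of_real (kth_eigval (projected_mat V M) (Suc i)))"
proof -
  let ?U = "ritz_mat N V u s"
  let ?p = "\<lambda>k. V *\<^sub>v u k"
  have V': "mat_adjoint V \<in> carrier_mat d N" using V by simp
  have uc: "u k \<in> carrier_vec d"
    and ev: "projected_mat V M *\<^sub>v u k = complex_of_real (kth_eigval (projected_mat V M) k) \<cdot>\<^sub>v u k"
    if "k \<in> {1..d}" for k using u that unfolding orthonormal_eigvecs_def by auto
  have on: "u i \<bullet>c u j = (if i = j then 1 else 0)" if "i \<in> {1..d}" "j \<in> {1..d}" for i j
    using u that unfolding orthonormal_eigvecs_def by auto
  have pc: "?p k \<in> carrier_vec N" if "k \<in> {1..d}" for k using V uc[OF that] by simp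
  have pp: "?p i \<bullet>c ?p j = (if i = j then 1 else 0)" if "i \<in> {1..d}" "j \<in> {1..d}" for i j
    using cscalar_prod_adjoint[OF V uc[OF that(1)] pc[OF that(2)]]
      assoc_mult_mat_vec[OF V' V uc[OF that(2)]] uc[OF that(2)] on[OF that] unfolding VV by simp
  show U: "?U \<in> carrier_mat N s" unfolding ritz_mat_def by (rule mat_of_cols_map_carrier)
  show "mat_adjoint ?U * ?U = 1\<^sub>m s"
    unfolding ritz_mat_def by (rule adjoint_mult_orthonormal_cols) (use pc pp s in auto)
  have col: "Matrix.col ?U i = ?p (Suc i)" if "i < s" for i
    unfolding ritz_mat_def by (rule col_mat_of_cols_map) (use pc s that in auto)
  have U': "mat_adjoint ?U \<in> carrier_mat s N" using U by simp
  have MU: "M * ?U \<in> carrier_mat N s" using M U by simp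
  show "mat_adjoint ?U * M * ?U = mat_diag s (\<lambda>i. complex_of_real (kth_eigval (projected_mat V M) (Suc i)))"
    unfolding assoc_mult_mat[OF U' M U]
  proof (rule eq_matI, goal_cases)
    case (1 i j)
    then have ij: "i < s" "j < s" by (auto simp: mat_diag_def)
    then have i: "Suc i \<in> {1..d}" and j: "Suc j \<in> {1..d}" using s by auto
    have Mp: "M *\<^sub>v ?p (Suc j) \<in> carrier_vec N" using M pc[OF j] by simp
    have "(M *\<^sub>v ?p (Suc j)) \<bullet>c ?p (Suc i) = (mat_adjoint V *\<^sub>v (M *\<^sub>v ?p (Suc j))) \<bullet>c u (Suc i)"
      using cscalar_prod_adjoint[OF V' Mp uc[OF i]] by simp
    also have "mat_adjoint V *\<^sub>v (M *\<^sub>v ?p (Suc j)) = projected_mat V M *\<^sub>v u (Suc j)"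
      unfolding projected_mat_def
      using assoc_mult_mat_vec[OF mult_carrier_mat[OF V' M] V uc[OF j]] assoc_mult_mat_vec[OF V' M pc[OF j]] by simp
    also have "\<dots> \<bullet>c u (Suc i) = complex_of_real (kth_eigval (projected_mat V M) (Suc j)) * (u (Suc j) \<bullet>c u (Suc i))"
      unfolding ev[OF j] by (rule cscalar_prod_smult_left[OF uc[OF j] uc[OF i]])
    also have "u (Suc j) \<bullet>c u (Suc i) = (if i = j then 1 else 0)" using on[OF j i] by simp
    finally have entry: "(M *\<^sub>v ?p (Suc j)) \<bullet>c ?p (Suc i)
      = complex_of_real (kth_eigval (projected_mat V M) (Suc j)) * (if i = j then 1 else 0)" .
    show ?case
      unfolding index_adjoint_mult_mat[OF U MU ij] col_mult2[OF M U ij(2)] col[OF ij(1)] col[OF ij(2)] entry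
      using ij by (auto simp: mat_diag_def)
  qed (use U in \<open>auto simp: mat_diag_def\<close>)
qed

lemma affine_mat_hermitian:
  assumes "\<And>q. q \<in> {1..Q} \<Longrightarrow> Aq q \<in> carrier_mat N N \<and> hermitian (Aq q)"
  shows "affine_mat N Q \<theta> Aq \<nu> \<in> carrier_mat N N" "hermitian (affine_mat N Q \<theta> Aq \<nu>)"
proof -
  show "affine_mat N Q \<theta> Aq \<nu> \<in> carrier_mat N N" unfolding affine_mat_def by simp
  have "cnj (index_mat (Aq q) (j, i)) = index_mat (Aq q) (i, j)" if "q \<in> {1..Q}" "i < N" "j < N" for q i j
    using assms[OF that(1)] index_mat_adjoint[of i "Aq q" j] that unfolding hermitian_def by auto
  then show "hermitian (affine_mat N Q \<theta> Aq \<nu>)"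
    unfolding hermitian_def by (intro eq_matI) (auto simp: affine_mat_def intro!: sum.cong)
qed

lemma qform_affine_mat:
  assumes A: "\<And>q. q \<in> {1..Q} \<Longrightarrow> Aq q \<in> carrier_mat N N" and x: "x \<in> carrier_vec N"
  shows "qform (affine_mat N Q \<theta> Aq \<nu>) x = (\<Sum>q=1..Q. \<theta> q \<nu> * qform (Aq q) x)"
proof -
  define f where "f = (\<lambda>q i j. vec_index x j * cnj (vec_index x i) * index_mat (Aq q) (i, j))"
  have q: "(\<Sum>i<N. (\<Sum>j<N. index_mat (Aq q) (i, j) * vec_index x j) * cnj (vec_index x i)) = (\<Sum>i<N. \<Sum>j<N. f q i j)" for q
    unfolding f_def sum_distrib_right by (intro sum.cong refl) (simp add: mult_ac)
  have c: "affine_mat N Q \<theta> Aq \<nu> \<in> carrier_mat N N" unfolding affine_mat_def by simp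
  have "(\<Sum>j<N. index_mat (affine_mat N Q \<theta> Aq \<nu>) (i, j) * vec_index x j) * cnj (vec_index x i)
      = (\<Sum>j<N. \<Sum>q=1..Q. complex_of_real (\<theta> q \<nu>) * f q i j)" if "i < N" for i
    unfolding sum_distrib_right
  proof (rule sum.cong[OF refl])
    fix j assume "j \<in> {..<N}"
    then have "index_mat (affine_mat N Q \<theta> Aq \<nu>) (i, j) = (\<Sum>q=1..Q. complex_of_real (\<theta> q \<nu>) * index_mat (Aq q) (i, j))"
      using that by (simp add: affine_mat_def)
    then show "index_mat (affine_mat N Q \<theta> Aq \<nu>) (i, j) * vec_index x j * cnj (vec_index x i)
      = (\<Sum>q=1..Q. complex_of_real (\<theta> q \<nu>) * f q i j)"
      by (simp add: f_def sum_distrib_left sum_distrib_right mult_ac)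
  qed
  then have "qform (affine_mat N Q \<theta> Aq \<nu>) x = Re (\<Sum>i<N. \<Sum>j<N. \<Sum>q=1..Q. complex_of_real (\<theta> q \<nu>) * f q i j)"
    unfolding qform_eq_sum[OF c x] by simp
  also have "(\<Sum>i<N. \<Sum>j<N. \<Sum>q=1..Q. complex_of_real (\<theta> q \<nu>) * f q i j)
      = (\<Sum>q=1..Q. \<Sum>i<N. \<Sum>j<N. complex_of_real (\<theta> q \<nu>) * f q i j)"
    by (simp only: sum.swap[of _ "{1..Q}" "{..<N}"])
  also have "\<dots> = (\<Sum>q=1..Q. complex_of_real (\<theta> q \<nu>) * (\<Sum>i<N. \<Sum>j<N. f q i j))"
    by (simp add: sum_distrib_left)
  also have "Re \<dots> = (\<Sum>q=1..Q. \<theta> q \<nu> * qform (Aq q) x)"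
    unfolding Re_sum by (intro sum.cong refl) (simp add: qform_eq_sum[OF A x] q)
  finally show ?thesis .
qed

text \<open>The infimum is over a real image, so it is a lower bound only because the box bounds the
  objective from below.\<close>

lemma eta_star_le:
  assumes "y \<in> Y" "Y \<subseteq> eig_box N Q Aq"
  shows "eta_star Q \<theta> \<mu> Y \<le> (\<Sum>q=1..Q. \<theta> q \<mu> * y q)"
  unfolding eta_star_def
proof (rule cINF_lower[OF bdd_belowI2 assms(1)])
  fix z assume "z \<in> Y"
  then have "z \<in> eig_box N Q Aq" using assms(2) by blast
  then have z: "kth_eigval (Aq q) 1 \<le> z q" "z q \<le> kth_eigval (Aq q) N" if "q \<in> {1..Q}" for q
    using PiE_mem[OF _ that] unfolding eig_box_def by fastforce+
  show "(\<Sum>q=1..Q. - (\<bar>\<theta> q \<mu>\<bar> * (\<bar>kth_eigval (Aq q) 1\<bar> + \<bar>kth_eigval (Aq q) N\<bar>))) \<le> (\<Sum>q=1..Q. \<theta> q \<mu> * z q)"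
  proof (rule sum_mono)
    fix q assume q: "q \<in> {1..Q}"
    have "\<bar>z q\<bar> \<le> \<bar>kth_eigval (Aq q) 1\<bar> + \<bar>kth_eigval (Aq q) N\<bar>" using z[OF q] by linarith
    then have "\<bar>\<theta> q \<mu> * z q\<bar> \<le> \<bar>\<theta> q \<mu>\<bar> * (\<bar>kth_eigval (Aq q) 1\<bar> + \<bar>kth_eigval (Aq q) N\<bar>)"
      unfolding abs_mult by (rule mult_left_mono) simp
    then show "- (\<bar>\<theta> q \<mu>\<bar> * (\<bar>kth_eigval (Aq q) 1\<bar> + \<bar>kth_eigval (Aq q) N\<bar>)) \<le> \<theta> q \<mu> * z q" by linarith
  qed
qed

text \<open>For a unit vector \<open>x\<close> orthogonal to the range of \<open>U\<close>, the tuple of its Rayleigh quotients with the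
  \<open>A\<^bsub>q\<^esub>\<close> is feasible for the linear program, and the objective at this point is its Rayleigh quotient with the
  affine combination. The general case follows by scaling.\<close>

lemma eta_star_le_qform:
  assumes A: "\<And>q. q \<in> {1..Q} \<Longrightarrow> Aq q \<in> carrier_mat N N \<and> hermitian (Aq q)"
    and w: "\<And>j. j \<in> {1..J} \<Longrightarrow> orthonormal_eigvecs N (affine_mat N Q \<theta> Aq (\<mu>s j)) (w (\<mu>s j))"
    and l: "\<And>j. j \<in> {1..J} \<Longrightarrow> 1 \<le> \<l> j \<and> \<l> j < N" and N: "0 < N"
    and U: "U \<in> carrier_mat N s" and UU: "mat_adjoint U * U = 1\<^sub>m s"
    and z: "z \<in> carrier_vec N" and perp: "mat_adjoint U *\<^sub>v z = 0\<^sub>v s"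
  shows "eta_star Q \<theta> \<mu> (Y_LB N Q \<theta> Aq w J \<mu>s \<l> U) * (cvec_norm z)\<^sup>2 \<le> qform (affine_mat N Q \<theta> Aq \<mu>) z"
    (is "?\<eta> * _ \<le> qform ?M z")
proof -
  have aff: "affine_mat N Q \<theta> Aq \<nu> \<in> carrier_mat N N" "hermitian (affine_mat N Q \<theta> Aq \<nu>)" for \<nu>
    by (rule affine_mat_hermitian, rule A, assumption)+
  show ?thesis
  proof (cases "cvec_norm z = 0")
    case True
    then have "z = 0\<^sub>v N" by (rule cvec_norm_eq_0[OF z])
    then have "qform ?M z = 0" using mult_mat_zero_vec[OF aff(1)] by (simp add: qform_def)
    then show ?thesis using True by simp
  next
    case False
    obtain x where x: "x \<in> carrier_vec N" "cvec_norm x = 1" "z = complex_of_real (cvec_norm z) \<cdot>\<^sub>v x"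
      using unit_vector_scaling[OF z False] by blast
    have "complex_of_real (cvec_norm z) \<cdot>\<^sub>v (mat_adjoint U *\<^sub>v x) = 0\<^sub>v s"
      using mult_mat_vec[OF mat_adjoint_carrier[OF U] x(1)] perp x(3) by metis
    then have px: "mat_adjoint U *\<^sub>v x = 0\<^sub>v s" using False U by (auto simp: vec_eq_iff)
    define y where "y = restrict (\<lambda>q. qform (Aq q) x) {1..Q}"
    have qy: "qform (affine_mat N Q \<theta> Aq \<nu>) x = (\<Sum>q=1..Q. \<theta> q \<nu> * y q)" for \<nu>
      using qform_affine_mat[of Q Aq N x \<theta> \<nu>] A x(1) by (simp add: y_def)
    have "y \<in> eig_box N Q Aq"
      unfolding eig_box_def y_def using qform_bounds[of _ N x] A N x by auto
    moreover have "kth_eigval (affine_mat N Q \<theta> Aq (\<mu>s j)) 1 + beta N (affine_mat N Q \<theta> Aq (\<mu>s j)) (w (\<mu>s j)) (\<l> j) U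
        \<le> (\<Sum>q=1..Q. \<theta> q (\<mu>s j) * y q)" if "j \<in> {1..J}" for j
      unfolding qy[symmetric]
      using beta_lower_bound[OF aff w[OF that] _ _ U UU x(1) px x(2)] l[OF that] by blast
    ultimately have "y \<in> Y_LB N Q \<theta> Aq w J \<mu>s \<l> U" unfolding Y_LB_def by blast
    then have "?\<eta> \<le> qform ?M x"
      unfolding qy by (rule eta_star_le) (auto simp: Y_LB_def)
    moreover have "qform ?M z = (cvec_norm z)\<^sup>2 * qform ?M x"
      using qform_smult[OF aff(1) x(1), where c = "complex_of_real (cvec_norm z)"] x(3) by simp
    ultimately show ?thesis by (simp add: mult.commute[of ?\<eta>] mult_left_mono)
  qed
qed

theorem theorem3p1:
  fixes P :: "(real ^ 'p::finite) set"
    and N Q m0 J s :: nat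
    and \<theta> :: "nat \<Rightarrow> real ^ 'p \<Rightarrow> real"
    and Aq :: "nat \<Rightarrow> complex mat"
    and A :: "real ^ 'p \<Rightarrow> complex mat"
    and w wV :: "real ^ 'p \<Rightarrow> nat \<Rightarrow> complex Matrix.vec"
    and \<mu>s :: "nat \<Rightarrow> real ^ 'p"
    and \<l> :: "nat \<Rightarrow> nat"
    and VJ :: "complex Matrix.vec set"
    and V U Uperp :: "complex mat"
    and \<mu> :: "real ^ 'p"
    and lamV :: "nat \<Rightarrow> real"
    and \<rho> \<eta> :: real
  assumes "compact P"
    and "\<And>q. q \<in> {1..Q} \<Longrightarrow> Aq q \<in> carrier_mat N N \<and> hermitian (Aq q)"
    and "\<And>q. q \<in> {1..Q} \<Longrightarrow> real_analytic_on (\<theta> q) P"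
    and A_def: "A = affine_mat N Q \<theta> Aq"
    and "\<And>\<nu>. \<nu> \<in> P \<Longrightarrow> orthonormal_eigvecs N (A \<nu>) (w \<nu>)"
    and "2 \<le> m0" and "m0 < N"
    and "\<And>\<nu>. \<nu> \<in> P \<Longrightarrow> second_distinct_eigval (A \<nu>) \<le> kth_eigval (A \<nu>) m0"
    and "\<And>\<nu>. \<nu> \<in> P \<Longrightarrow> kth_eigval (A \<nu>) m0 < kth_eigval (A \<nu>) (m0 + 1)"
    and "\<And>j. j \<in> {1..J} \<Longrightarrow> \<mu>s j \<in> P"
    and "\<And>j. j \<in> {1..J} \<Longrightarrow> 1 \<le> \<l> j \<and> \<l> j < N"
    and VJ_def: "VJ = snapshot_space N w J \<mu>s \<l>"
    and "is_onb_matrix N V VJ"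
    and "\<And>\<nu>. \<nu> \<in> P \<Longrightarrow> orthonormal_eigvecs (dim_col V) (projected_mat V (A \<nu>)) (wV \<nu>)"
    and "\<mu> \<in> P"
    and lamV_def: "lamV = kth_eigval (projected_mat V (A \<mu>))"
    and "s \<in> {1..cdim N VJ}"
    and "s < cdim N VJ \<Longrightarrow> lamV s < lamV (s + 1)"
    and "N \<ge> 2 * s"
    and U_def: "U = ritz_mat N V (wV \<mu>) s"
    and "is_onb_matrix N Uperp (orth_complement N (cspan N (set (cols U))))"
    and \<rho>_def: "\<rho> = residual (A \<mu>) U Uperp"
    and \<eta>_def: "\<eta> = eta_star Q \<theta> \<mu> (Y_LB N Q \<theta> Aq w J \<mu>s \<l> U)"
  shows "\<forall>k\<in>{1..s}. lambda_SLB lamV \<eta> \<rho> k \<le> kth_eigval (A \<mu>) k"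
proof
  fix k assume k: "k \<in> {1..s}"
  note herm = assms(2) and eig = assms(5) and snap = assms(10) and ell = assms(11)
    and onbV = assms(13) and ritz = assms(14) and \<mu> = assms(15) and s = assms(17)
    and Ns = assms(19) and onbU = assms(21)
  have sd: "s \<le> dim_col V" "0 < s" using s cdim_eq_dim_col[OF onbV] by auto
  note V = is_onb_matrixD[OF onbV]
  have M: "A \<mu> \<in> carrier_mat N N" "hermitian (A \<mu>)"
    unfolding A_def by (rule affine_mat_hermitian, rule herm, assumption)+
  have U: "U \<in> carrier_mat N s" "mat_adjoint U * U = 1\<^sub>m s"
    "mat_adjoint U * A \<mu> * U = mat_diag s (\<lambda>i. complex_of_real (lamV (Suc i)))"
    unfolding U_def lamV_def by (rule ritz_mat_properties[OF V(1,2) M(1) ritz[OF \<mu>] sd(1)])+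
  have "mat_adjoint V \<in> carrier_mat (dim_col V) N" by (rule mat_adjoint_carrier[OF V(1)])
  then have pm: "projected_mat V (A \<mu>) \<in> carrier_mat (dim_col V) (dim_col V)"
    unfolding projected_mat_def using M(1) V(1) by (intro mult_carrier_mat)
  have U': "mat_adjoint Uperp * A \<mu> * U \<in> carrier_mat (dim_col Uperp) s"
    by (rule mult_carrier_mat[OF mult_carrier_mat[OF mat_adjoint_carrier[OF is_onb_matrixD(1)[OF onbU]] M(1)] U(1)])
  show "lambda_SLB lamV \<eta> \<rho> k \<le> kth_eigval (A \<mu>) k"
  proof (rule two_block_eigenvalue_bound[OF M eig[OF \<mu>] U])
    show "lamV i \<le> lamV j" if "1 \<le> i" "i \<le> j" "j \<le> s" for i j
      unfolding lamV_def using kth_eigval_mono[OF pm that(1,2)] that(3) sd by simp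
    show "\<eta> * (cvec_norm z)\<^sup>2 \<le> qform (A \<mu>) z"
      if "z \<in> carrier_vec N" "mat_adjoint U *\<^sub>v z = 0\<^sub>v s" for z
      unfolding \<eta>_def A_def
      by (rule eta_star_le_qform[OF herm _ _ _ U(1,2) that]) (use eig snap ell Ns sd in \<open>auto simp: A_def\<close>)
    show "cmod ((A \<mu> *\<^sub>v (U *\<^sub>v a)) \<bullet>c z) \<le> \<rho> * (cvec_norm a * cvec_norm z)"
      if "a \<in> carrier_vec s" "z \<in> carrier_vec N" "mat_adjoint U *\<^sub>v z = 0\<^sub>v s" for a z
      unfolding \<rho>_def by (rule residual_bound[OF M(1) U(1) sd(2) onbU that])
    show "0 \<le> \<rho>" unfolding \<rho>_def residual_def by (rule spectral_norm_nonneg[OF U' sd(2)])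
  qed (use k Ns in auto)
qed

end
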